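(* Let $M$ be a matroid having positive rank $r$, on an $n$-element set. For any $(n,r-1)$-composition $(a_0,a_1,\ldots,a_{r-2},a'_{r-1})$, the number of flags of $\mathrm{Trun}(M)$ that have that composition, that is, $\nu(\mathrm{Trun}(M);a_0,a_1,\ldots,a_{r-2},a'_{r-1})$, is $$\sum_{\substack{a_{r-1},a_r\in\mathbb{N}\,:\\ a_{r-1}+a_r=a'_{r-1}}}\nu(M;a_0,a_1,\ldots,a_{r-2},a_{r-1},a_r)\cdot\frac{a_{r-1}}{a_{r-1}+a_r}.$$ Thus, $$\mathcal{G}(\mathrm{Trun}(M))=\sum\nu(M;a_0,a_1,\ldots,a_r)\cdot\frac{a_{r-1}}{a_{r-1}+a_r}\cdot\gamma(a_0,a_1,\ldots,a_{r-2},a_{r-1}+a_r),$$ where the sum is over all $(n,r)$-compositions $(a_0,a_1,\ldots,a_r)$.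
   Context: The truncation $\mathrm{Trun}(M)$ of a matroid $M$ of positive rank is the matroid on the same set whose bases are the independent sets of $M$ of size $r(M)-1$. $\mathbb{N}$ denotes the positive integers. An $(n,r)$-composition is an integer sequence $(a_0,a_1,\ldots,a_r)$ with $a_0\ge0$, $a_j>0$ for $1\le j\le r$, and $a_0+\cdots+a_r=n$. A flag of a rank-$r$ matroid $M$ on an $n$-set $E$ is a chain $X_0\subset X_1\subset\cdots\subset X_r=E$ of flats with $r(X_j)=j$; its composition is $(|X_0|,|X_1-X_0|,\ldots,|X_r-X_{r-1}|)$. $\nu(M;a_0,\ldots,a_r)$ is the number of flags of $M$ with composition $(a_0,\ldots,a_r)$. $\mathcal{G}(n,r)$ is the vector space over a field of characteristic zero with basis the formal symbols $[\underline{r}]$, one for each $0,1$-sequence of length $n$ with exactly $r$ ones. For a permutation (linear ordering) $\pi$ of $E$, the rank sequence $\underline{r}(\pi)=r_1\ldots r_n$ has $r_j=r(\{\pi(1),\ldots,\pi(j)\})-r(\{\pi(1),\ldots,\pi(j-1)\})$, and $\mathcal{G}(M)=\sum_\pi[\underline{r}(\pi)]\in\mathcal{G}(n,r)$ over all $n!$ permutations of $E$. Write $(b_0,\ldots,b_r)\trianglerighteq(a_0,\ldots,a_r)$ if $b_0+\cdots+b_j\le a_0+\cdots+a_j$ for all $j$, and $(t)_k=t(t-1)\cdots(t-k+1)$. For an $(n,r)$-composition $(a_0,\ldots,a_r)$, $$\gamma(a_0,\ldots,a_r)=\sum_{(b_j)\trianglerighteq(a_j)}(a_0)_{b_0}\Biggl(\prod_{j=1}^r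 a_j\Bigl(a_j-1+\sum_{i=0}^{j-1}(a_i-b_i)\Bigr)_{b_j-1}\Biggr)[0^{b_0}10^{b_1-1}\ldots10^{b_r-1}],$$ the sum over $(n,r)$-compositions $(b_0,\ldots,b_r)\trianglerighteq(a_0,\ldots,a_r)$; $0^b$ denotes a run of $b$ zeros.
   Formalization: The rank r is assumed to be at least 2 rather than merely positive: for r = 1 both formulas fail for every matroid (with l < n loops, ν(Trun(M); n) = 1 but the right-hand side is l/n). *)

theory Defs
  imports
    Complex_Main
    "HOL-Library.Poly_Mapping"
    "HOL-Combinatorics.Multiset_Permutations"
begin

record 'a set_system =
  ground :: "'a set"
  indeps :: "'a set set"

locale matroid =
  fixes M :: "'a set_system"
  assumes finite_ground: "finite (ground M)"
    and indep_ground: "X \<in> indeps M \<Longrightarrow> X \<subseteq> ground M"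
    and indep_empty: "{} \<in> indeps M"
    and indep_subset: "X \<in> indeps M \<Longrightarrow> Y \<subseteq> X \<Longrightarrow> Y \<in> indeps M"
    and indep_augment: "X \<in> indeps M \<Longrightarrow> Y \<in> indeps M \<Longrightarrow> card X < card Y \<Longrightarrow>
      \<exists>y\<in>Y - X. insert y X \<in> indeps M"

definition bases :: "'a set_system \<Rightarrow> 'a set set" where
  "bases M = {B \<in> indeps M. \<forall>X\<in>indeps M. B \<subseteq> X \<longrightarrow> X = B}"

definition mrank :: "'a set_system \<Rightarrow> 'a set \<Rightarrow> nat" where
  "mrank M X = Max (card ` {Y \<in> indeps M. Y \<subseteq> X})"

definition matroid_of_bases :: "'a set \<Rightarrow> 'a set set \<Rightarrow> 'a set_system" where
  "matroid_of_bases E \<B> = \<lparr>ground = E, indeps = {X. \<exists>B\<in>\<B>. X \<subseteq> B}\<rparr>"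

text \<open>Intended for matroids of positive rank only.\<close>

definition Trun :: "'a set_system \<Rightarrow> 'a set_system" where
  "Trun M = matroid_of_bases (ground M) {B \<in> indeps M. card B = mrank M (ground M) - 1}"

definition is_flat :: "'a set_system \<Rightarrow> 'a set \<Rightarrow> bool" where
  "is_flat M X \<longleftrightarrow> X \<subseteq> ground M \<and> (\<forall>x\<in>ground M - X. mrank M X < mrank M (insert x X))"

text \<open>The list \<open>[a\<^sub>0, \<dots>, a\<^sub>r]\<close> encodes the sequence \<open>(a\<^sub>0, \<dots>, a\<^sub>r)\<close>.\<close>

definition compositions :: "nat \<Rightarrow> nat \<Rightarrow> nat list set" where
  "compositions n r = {a. length a = Suc r \<and> (\<forall>j\<in>{1..r}. 0 < a ! j) \<and> sum_list a = n}"

definition flags :: "'a set_system \<Rightarrow> 'a set list set" where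
  "flags M = {Xs. length Xs = Suc (mrank M (ground M)) \<and>
     (\<forall>j<length Xs. is_flat M (Xs ! j) \<and> mrank M (Xs ! j) = j) \<and>
     (\<forall>j. Suc j < length Xs \<longrightarrow> Xs ! j \<subset> Xs ! Suc j) \<and>
     Xs ! mrank M (ground M) = ground M}"

definition flag_composition :: "'a set list \<Rightarrow> nat list" where
  "flag_composition Xs =
     map (\<lambda>j. if j = 0 then card (Xs ! 0) else card (Xs ! j - Xs ! (j - 1))) [0..<length Xs]"

definition nu :: "'a set_system \<Rightarrow> nat list \<Rightarrow> nat" where
  "nu M a = card {Xs \<in> flags M. flag_composition Xs = a}"

text \<open>
  All the spaces \<open>\<G>(n,r)\<close> live in the free vector space on the 0,1-sequences of arbitrary length;
  \<open>G_space n r\<close> is the span of the symbols of length \<open>n\<close> with \<open>r\<close> ones.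
\<close>

definition symbol :: "nat list \<Rightarrow> (nat list \<Rightarrow>\<^sub>0 'k::field_char_0)" where
  "symbol s = Poly_Mapping.single s 1"

definition scale :: "'k::field_char_0 \<Rightarrow> (nat list \<Rightarrow>\<^sub>0 'k) \<Rightarrow> (nat list \<Rightarrow>\<^sub>0 'k)" where
  "scale c v = Poly_Mapping.map ((*) c) v"

definition G_space :: "nat \<Rightarrow> nat \<Rightarrow> (nat list \<Rightarrow>\<^sub>0 'k::field_char_0) set" where
  "G_space n r =
     {v. Poly_Mapping.keys v \<subseteq> {s. length s = n \<and> set s \<subseteq> {0, 1} \<and> sum_list s = r}}"

text \<open>
  A permutation of the ground set is the list of its values. The subtraction on naturals does not
  truncate, since the rank is monotone.
\<close>

definition rank_sequence :: "'a set_system \<Rightarrow> 'a list \<Rightarrow> nat list" where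
  "rank_sequence M \<pi> =
     map (\<lambda>j. mrank M (set (take (Suc j) \<pi>)) - mrank M (set (take j \<pi>))) [0..<length \<pi>]"

definition G_inv :: "'a set_system \<Rightarrow> (nat list \<Rightarrow>\<^sub>0 'k::field_char_0)" where
  "G_inv M = (\<Sum>\<pi>\<in>permutations_of_set (ground M). symbol (rank_sequence M \<pi>))"

definition comp_dominates :: "nat list \<Rightarrow> nat list \<Rightarrow> bool" (infix "\<unrhd>" 50) where
  "b \<unrhd> a \<longleftrightarrow> length b = length a \<and>
     (\<forall>j<length a. (\<Sum>i\<le>j. b ! i) \<le> (\<Sum>i\<le>j. a ! i))"

definition falling_fact :: "int \<Rightarrow> nat \<Rightarrow> int" where
  "falling_fact t k = (\<Prod>i<k. t - int i)"

definition comp_sequence :: "nat list \<Rightarrow> nat list" where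
  "comp_sequence b =
     replicate (b ! 0) 0 @ concat (map (\<lambda>j. 1 # replicate (b ! j - 1) 0) [1..<length b])"

text \<open>
  The summand \<open>a\<^sub>i - b\<^sub>i\<close> may be negative, hence the integers; \<open>b\<^sub>j - 1\<close> is a natural
  number because \<open>b\<^sub>j > 0\<close> for \<open>j > 0\<close>.
\<close>

definition gamma :: "nat list \<Rightarrow> (nat list \<Rightarrow>\<^sub>0 'k::field_char_0)" where
  "gamma a = (\<Sum>b\<in>{b \<in> compositions (sum_list a) (length a - 1). b \<unrhd> a}.
     scale (of_int (falling_fact (int (a ! 0)) (b ! 0) *
         (\<Prod>j=1..length a - 1. int (a ! j) *
            falling_fact (int (a ! j) - 1 + (\<Sum>i<j. int (a ! i) - int (b ! i))) (b ! j - 1))))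
       (symbol (comp_sequence b)))"


lemma lookup_scale: "Poly_Mapping.lookup (scale c v) s = c * Poly_Mapping.lookup v s"
  by (simp add: scale_def map.rep_eq when_def)

lemma vector_space_scale: "vector_space scale"
  by unfold_locales
    (auto intro!: poly_mapping_eqI simp: lookup_scale lookup_add algebra_simps)

lemma finite_compositions: "finite (compositions n r)"
proof (rule finite_subset)
  show "compositions n r \<subseteq> {a. set a \<subseteq> {..n} \<and> length a = Suc r}"
    by (auto simp: compositions_def dest: member_le_sum_list)
  show "finite {a. set a \<subseteq> {..n} \<and> length a = Suc r}"
    by (rule finite_lists_length_eq) simp
qed

context matroid
begin

lemma finite_indep: "X \<in> indeps M \<Longrightarrow> finite X"
  using finite_ground indep_ground finite_subset by blast

lemma finite_indeps: "finite (indeps M)"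
  using finite_ground indep_ground by (meson PowI finite_Pow_iff finite_subset subsetI)

lemma mrank_ge: "Y \<in> indeps M \<Longrightarrow> Y \<subseteq> X \<Longrightarrow> card Y \<le> mrank M X"
  unfolding mrank_def using finite_indeps by (intro Max_ge) auto

lemma mrank_witness: "\<exists>Y\<in>indeps M. Y \<subseteq> X \<and> card Y = mrank M X"
proof -
  have "mrank M X \<in> card ` {Y \<in> indeps M. Y \<subseteq> X}"
    unfolding mrank_def using finite_indeps indep_empty by (intro Max_in) auto
  then show ?thesis by auto
qed

lemma mrank_mono: "X \<subseteq> Y \<Longrightarrow> mrank M X \<le> mrank M Y"
  by (metis mrank_ge mrank_witness order_trans)

lemma indep_extend:
  assumes "X \<in> indeps M" "card X \<le> k" "k \<le> mrank M (ground M)"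
  shows "\<exists>B\<in>indeps M. X \<subseteq> B \<and> card B = k"
  using assms(2,3)
proof (induction k rule: dec_induct)
  case base
  then show ?case using assms(1) by blast
next
  case (step k)
  then obtain B where B: "B \<in> indeps M" "X \<subseteq> B" "card B = k" by auto
  obtain Y where Y: "Y \<in> indeps M" "card Y = mrank M (ground M)" using mrank_witness by blast
  obtain y where "y \<in> Y - B" "insert y B \<in> indeps M"
    using indep_augment[OF B(1) Y(1)] B(3) Y(2) step by auto
  then show ?case using B finite_indep by (intro bexI[of _ "insert y B"]) auto
qed

lemma indeps_Trun:
  "indeps (Trun M) = {X \<in> indeps M. card X \<le> mrank M (ground M) - 1}"
proof (intro set_eqI iffI)
  fix X assume "X \<in> indeps (Trun M)"
  then obtain B where "B \<in> indeps M" "card B = mrank M (ground M) - 1" "X \<subseteq> B"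
    by (auto simp: Trun_def matroid_of_bases_def)
  then show "X \<in> {X \<in> indeps M. card X \<le> mrank M (ground M) - 1}"
    using indep_subset[of B X] card_mono[OF finite_indep, of B X] by simp
next
  fix X assume "X \<in> {X \<in> indeps M. card X \<le> mrank M (ground M) - 1}"
  then show "X \<in> indeps (Trun M)"
    using indep_extend[of X "mrank M (ground M) - 1"]
    by (auto simp: Trun_def matroid_of_bases_def)
qed

lemma ground_Trun: "ground (Trun M) = ground M"
  by (simp add: Trun_def matroid_of_bases_def)

lemma matroid_Trun: "matroid (Trun M)"
proof
  show "finite (ground (Trun M))" by (simp add: ground_Trun finite_ground)
  show "{} \<in> indeps (Trun M)" by (simp add: indeps_Trun indep_empty)
next
  fix X assume "X \<in> indeps (Trun M)"
  then show "X \<subseteq> ground (Trun M)" by (simp add: indeps_Trun ground_Trun indep_ground)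
next
  fix X Y assume "X \<in> indeps (Trun M)" "Y \<subseteq> X"
  then show "Y \<in> indeps (Trun M)"
    using indep_subset[of X Y] card_mono[OF finite_indep, of X Y] by (simp add: indeps_Trun)
next
  fix X Y assume "X \<in> indeps (Trun M)" "Y \<in> indeps (Trun M)" "card X < card Y"
  then show "\<exists>y\<in>Y - X. insert y X \<in> indeps (Trun M)"
    using indep_augment[of X Y] finite_indep[of X]
    by (simp add: indeps_Trun)
qed

lemma bases_Trun: "bases (Trun M) = {B \<in> indeps M. card B = mrank M (ground M) - 1}"
proof (intro set_eqI iffI)
  fix B assume B: "B \<in> bases (Trun M)"
  then have BI: "B \<in> indeps M" "card B \<le> mrank M (ground M) - 1"
    by (auto simp: bases_def indeps_Trun)
  then obtain C where "C \<in> indeps M" "B \<subseteq> C" "card C = mrank M (ground M) - 1"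
    using indep_extend[of B "mrank M (ground M) - 1"] by auto
  moreover from this have "C = B" using B by (auto simp: bases_def indeps_Trun)
  ultimately show "B \<in> {B \<in> indeps M. card B = mrank M (ground M) - 1}" by simp
next
  fix B assume "B \<in> {B \<in> indeps M. card B = mrank M (ground M) - 1}"
  then have B: "B \<in> indeps M" "card B = mrank M (ground M) - 1" by auto
  have "X = B" if "X \<in> indeps M" "card X \<le> mrank M (ground M) - 1" "B \<subseteq> X" for X
    using card_seteq[OF finite_indep[OF that(1)] that(3)] that(2) B(2) by simp
  then show "B \<in> bases (Trun M)" using B by (simp add: bases_def indeps_Trun)
qed

lemma mrank_Trun: "mrank (Trun M) (ground M) = mrank M (ground M) - 1"
proof -
  interpret T: matroid "Trun M" by (rule matroid_Trun)
  obtain B where "B \<in> indeps M" "card B = mrank M (ground M) - 1"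
    using indep_extend[OF indep_empty, of "mrank M (ground M) - 1"] by auto
  then have "mrank M (ground M) - 1 \<le> mrank (Trun M) (ground M)"
    using T.mrank_ge[of B "ground M"] by (simp add: indeps_Trun indep_ground)
  moreover obtain Y where "Y \<in> indeps (Trun M)" "card Y = mrank (Trun M) (ground M)"
    using T.mrank_witness by blast
  ultimately show ?thesis by (simp add: indeps_Trun)
qed

lemma finite_flags: "finite (flags M)"
proof (rule finite_subset)
  show "flags M \<subseteq> {Xs. set Xs \<subseteq> Pow (ground M) \<and> length Xs = Suc (mrank M (ground M))}"
    unfolding flags_def is_flat_def by (force simp: in_set_conv_nth)
  show "finite {Xs. set Xs \<subseteq> Pow (ground M) \<and> length Xs = Suc (mrank M (ground M))}"
    using finite_ground by (intro finite_lists_length_eq) simp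
qed

lemma mrank_empty: "mrank M {} = 0"
  using mrank_witness[of "{}"] by auto

lemma mrank_insert_le: "mrank M (insert x X) \<le> Suc (mrank M X)"
proof -
  obtain Y where Y: "Y \<in> indeps M" "Y \<subseteq> insert x X" "card Y = mrank M (insert x X)"
    using mrank_witness by blast
  have "card (Y - {x}) \<le> mrank M X"
    using Y indep_subset by (intro mrank_ge) auto
  then show ?thesis using Y(3) by (auto simp: card_Diff_singleton_if split: if_splits)
qed

lemma G_inv_in_G_space:
  "(G_inv M :: nat list \<Rightarrow>\<^sub>0 'k::field_char_0) \<in> G_space (card (ground M)) (mrank M (ground M))"
proof -
  let ?S = "{s. length s = card (ground M) \<and> set s \<subseteq> {0, 1} \<and> sum_list s = mrank M (ground M)}"
  have "rank_sequence M \<pi> \<in> ?S" if "\<pi> \<in> permutations_of_set (ground M)" for \<pi>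
  proof -
    let ?f = "\<lambda>j. mrank M (set (take j \<pi>))"
    have \<pi>: "set \<pi> = ground M" "length \<pi> = card (ground M)"
      using that distinct_card[of \<pi>] by (auto simp: permutations_of_set_def)
    have le: "?f j \<le> ?f (Suc j)" for j
      by (intro mrank_mono set_take_subset_set_take) simp
    have step: "?f (Suc j) - ?f j \<in> {0, 1}" if "j < length \<pi>" for j
      using mrank_insert_le[of "\<pi> ! j" "set (take j \<pi>)"] that
      by (auto simp: take_Suc_conv_app_nth)
    have "(\<Sum>j<k. ?f (Suc j) - ?f j) = ?f k" for k
      using le by (induction k) (auto simp: mrank_empty)
    then have "sum_list (rank_sequence M \<pi>) = ?f (length \<pi>)"
      by (simp add: rank_sequence_def interv_sum_list_conv_sum_set_nat atLeast0LessThan)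
    moreover have "set (rank_sequence M \<pi>) \<subseteq> {0, 1}"
      using step by (simp add: rank_sequence_def image_subset_iff del: insert_iff)
    ultimately show ?thesis using \<pi> by (simp add: rank_sequence_def)
  qed
  then have "Poly_Mapping.keys (G_inv M :: nat list \<Rightarrow>\<^sub>0 'k) \<subseteq> ?S"
    unfolding G_inv_def symbol_def
    by (intro order_trans[OF keys_sum]) auto
  then show ?thesis by (simp add: G_space_def)
qed

end

end

theory Submission
  imports Defs
begin

text \<open>
  Every permutation \<open>\<pi>\<close> of the ground set determines a flag, whose flat of rank \<open>j\<close> is the closure of
  the prefixes of \<open>\<pi>\<close> of rank \<open>j\<close>. The permutations with a given flag of composition \<open>a\<close> and rank
  sequence \<open>0\<^bsup>b\<^sub>0\<^esup> 1 0\<^bsup>b\<^sub>1-1\<^esup> \<dots>\<close> are built from left to right: the \<open>j\<close>-th entry 1 is placed by an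
  element of \<open>X\<^sub>j - X\<^bsub>j-1\<^esub>\<close>, each entry 0 by an unused element of the current flat. This yields the
  coefficients of \<open>\<gamma>(a)\<close>, hence \<open>\<G>(M) = \<Sum> \<nu>(M; a) \<gamma>(a)\<close> for every matroid.

  A flag of the truncation is a flag of \<open>M\<close> with its hyperplane \<open>X\<^bsub>r-1\<^esub>\<close> left out. The hyperplanes \<open>H\<close>
  that cover the flat \<open>X = X\<^bsub>r-2\<^esub>\<close> partition \<open>E - X\<close> into the sets \<open>H - X\<close>, so weighting each flag of
  \<open>M\<close> by \<open>|H - X| / |E - X|\<close> counts each flag of the truncation once.
\<close>

section \<open>Compositions and 0,1-sequences\<close>

lemma falling_fact_Suc: "falling_fact t (Suc k) = falling_fact t k * (t - int k)"
  by (simp add: falling_fact_def)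

text \<open>The factor with index \<open>t\<close> is zero. This covers the counts in which the
  available elements run out.\<close>

lemma falling_fact_eq_0:
  assumes "0 \<le> t" "t < int k"
  shows "falling_fact t k = 0"
  unfolding falling_fact_def using assms
  by (intro prod_zero bexI[of _ "nat t"]) auto

section \<open>Block structure of \<open>comp_sequence\<close>\<close>

lemma comp_sequence_singleton: "comp_sequence [c] = replicate c 0"
  by (simp add: comp_sequence_def)

lemma comp_sequence_snoc:
  assumes "b \<noteq> []"
  shows "comp_sequence (b @ [c]) = comp_sequence b @ 1 # replicate (c - 1) 0"
proof -
  have "map (\<lambda>j. 1 # replicate ((b @ [c]) ! j - 1) 0) [1..<length b] =
      map (\<lambda>j. 1 # replicate (b ! j - 1) (0::nat)) [1..<length b]"
    by (intro map_cong) (auto simp: nth_append)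
  moreover have "[1..<length (b @ [c])] = [1..<length b] @ [length b]"
    using assms by (cases b) auto
  moreover have "(b @ [c]) ! 0 = b ! 0"
    using assms by (simp add: nth_append)
  ultimately show ?thesis unfolding comp_sequence_def by (simp only: map_append concat_append) simp
qed

lemma set_comp_sequence: "set (comp_sequence b) \<subseteq> {0, 1}"
  by (auto simp: comp_sequence_def)

lemma sum_list_comp_sequence: "b \<noteq> [] \<Longrightarrow> sum_list (comp_sequence b) = length b - 1"
proof (induction b rule: rev_nonempty_induct)
  case (single c)
  then show ?case by (simp add: comp_sequence_singleton sum_list_replicate)
next
  case (snoc c b)
  then show ?case by (simp add: comp_sequence_snoc sum_list_replicate Suc_diff_Suc)
qed

text \<open>Positivity makes the natural subtraction in \<open>b ! j - 1\<close> exact, so block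
  \<open>j\<close> has length \<open>b ! j\<close>. Block 0 contains no 1, so \<open>b ! 0\<close>
  may vanish.\<close>

lemma length_comp_sequence:
  "b \<noteq> [] \<Longrightarrow> \<forall>j\<in>{1..<length b}. 0 < b ! j \<Longrightarrow> length (comp_sequence b) = sum_list b"
proof (induction b rule: rev_nonempty_induct)
  case (single c)
  then show ?case by (simp add: comp_sequence_singleton)
next
  case (snoc c b)
  have "0 < (b @ [c]) ! length b"
    using snoc.hyps by (intro bspec[OF snoc.prems]) (cases b, auto)
  moreover have "0 < b ! j" if "j \<in> {1..<length b}" for j
    using bspec[OF snoc.prems, of j] that by (simp add: nth_append)
  ultimately show ?case using snoc by (simp add: comp_sequence_snoc)
qed

text \<open>The counts below run along the prefixes of \<open>comp_sequence b\<close> that end with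
  a block. The number of ones is the index of the current set of the chain, the length is the number
  of elements already placed.\<close>

lemma comp_sequence_take:
  assumes "b \<in> compositions n r" "k \<le> r"
  shows "length (comp_sequence (take (Suc k) b)) = (\<Sum>i\<le>k. b ! i)"
    and "sum_list (comp_sequence (take (Suc k) b)) = k"
proof -
  have b: "length b = Suc r" "\<forall>j\<in>{1..r}. 0 < b ! j"
    using assms(1) by (auto simp: compositions_def)
  then have ne: "take (Suc k) b \<noteq> []" by auto
  have "\<forall>j\<in>{1..<length (take (Suc k) b)}. 0 < take (Suc k) b ! j"
    using b assms(2) by auto
  then have "length (comp_sequence (take (Suc k) b)) = sum_list (take (Suc k) b)"
    using ne by (intro length_comp_sequence)
  also have "\<dots> = (\<Sum>i\<le>k. b ! i)"
    using b assms(2)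
    by (auto simp: sum_list_sum_nth min_def atLeast0LessThan lessThan_Suc_atMost intro!: sum.cong)
  finally show "length (comp_sequence (take (Suc k) b)) = (\<Sum>i\<le>k. b ! i)" .
  show "sum_list (comp_sequence (take (Suc k) b)) = k"
    using sum_list_comp_sequence[OF ne] b assms(2) by simp
qed

lemma comp_sequence_append: "b \<noteq> [] \<Longrightarrow> \<exists>t. comp_sequence (b @ c) = comp_sequence b @ t"
proof (induction c rule: rev_induct)
  case (snoc x c)
  then obtain t where "comp_sequence (b @ c) = comp_sequence b @ t" by auto
  then show ?case using comp_sequence_snoc[of "b @ c" x] snoc.prems by simp
qed simp

text \<open>The trailing run of zeros is read off the reversed list, as the part before its first
  nonzero entry.\<close>

lemma append_one_zeros_eqD:
  fixes s t :: "nat list"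
  assumes "s @ 1 # replicate k 0 = t @ 1 # replicate l 0"
  shows "s = t \<and> k = l"
proof -
  have zeros: "takeWhile (\<lambda>x. x = 0) (rev (u @ 1 # replicate m 0)) = replicate m 0"
    for u :: "nat list" and m
    by (simp add: takeWhile_append2 takeWhile_tail)
  have "replicate k (0::nat) = replicate l 0"
    using arg_cong[OF assms, of "\<lambda>u. takeWhile (\<lambda>x. x = 0) (rev u)"] by (simp only: zeros)
  then have "k = l" by simp
  then show ?thesis using assms by simp
qed

lemma comp_sequence_eqD:
  "b \<noteq> [] \<Longrightarrow> length c = length b \<Longrightarrow> \<forall>j\<in>{1..<length b}. 0 < b ! j \<Longrightarrow>
    \<forall>j\<in>{1..<length b}. 0 < c ! j \<Longrightarrow> comp_sequence b = comp_sequence c \<Longrightarrow> b = c"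
proof (induction b arbitrary: c rule: rev_nonempty_induct)
  case (single x)
  then obtain y where "c = [y]" by (auto simp: length_Suc_conv)
  then show ?case using single by (simp add: comp_sequence_singleton)
next
  case (snoc x b)
  then obtain d y where c: "c = d @ [y]" "length d = length b"
    by (metis length_append_singleton length_Suc_conv_rev)
  have ne: "d \<noteq> []" using c(2) snoc.hyps by auto
  have last: "length b \<in> {1..<length (b @ [x])}" using snoc.hyps by (cases b) auto
  have pos: "0 < x" "0 < y"
    using bspec[OF snoc.prems(2) last] bspec[OF snoc.prems(3) last] c by (auto simp: nth_append)
  have "0 < b ! j \<and> 0 < d ! j" if "j \<in> {1..<length b}" for j
    using bspec[OF snoc.prems(2), of j] bspec[OF snoc.prems(3), of j] that c
    by (simp add: nth_append)
  then have "\<forall>j\<in>{1..<length b}. 0 < b ! j" "\<forall>j\<in>{1..<length b}. 0 < d ! j" by blast+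
  moreover have "comp_sequence b = comp_sequence d \<and> x - 1 = y - 1"
    using snoc.prems(4) snoc.hyps ne
    unfolding c(1) comp_sequence_snoc[OF snoc.hyps] comp_sequence_snoc[OF ne]
    by (intro append_one_zeros_eqD)
  ultimately show ?case using snoc.IH[of d] c pos by auto
qed

lemma inj_on_comp_sequence: "inj_on comp_sequence (compositions n r)"
  by (rule inj_onI, rule comp_sequence_eqD) (auto simp: compositions_def)

text \<open>Read from left to right, an entry 1 opens a new block of length 1 and an entry 0
  lengthens the last block. Together with \<open>inj_on_comp_sequence\<close>, compositions thus
  index the 0,1-sequences.\<close>

lemma comp_sequence_in_image:
  assumes "set s \<subseteq> {0, 1}"
  shows "s \<in> comp_sequence ` compositions (length s) (sum_list s)"
  using assms
proof (induction s rule: rev_induct)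
  case Nil
  then show ?case
    by (intro image_eqI[of _ _ "[0]"]) (auto simp: comp_sequence_singleton compositions_def)
next
  case (snoc e s)
  then obtain b where b: "b \<in> compositions (length s) (sum_list s)" "s = comp_sequence b"
    by auto
  then have len: "length b = Suc (sum_list s)" by (simp add: compositions_def)
  then have ne: "b \<noteq> []" by auto
  have "e = 0 \<or> e = 1" using snoc.prems by auto
  then show ?case
  proof
    assume e: "e = 1"
    have "comp_sequence (b @ [1]) = s @ [e]" using b ne e by (simp add: comp_sequence_snoc)
    moreover have "b @ [1] \<in> compositions (length (s @ [e])) (sum_list (s @ [e]))"
      using b e by (auto simp: compositions_def nth_append)
    ultimately show ?thesis by (metis image_eqI)
  next
    assume e: "e = 0"
    obtain d c where d: "b = d @ [c]" using ne by (cases b rule: rev_cases) auto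
    have "d @ [Suc c] \<in> compositions (length (s @ [e])) (sum_list (s @ [e]))"
      using b e d by (auto simp: compositions_def nth_append split: if_splits)
    moreover have "comp_sequence (d @ [Suc c]) = s @ [e]"
    \<comment> \<open>Block 0 is a bare run of zeros; every later block starts with a 1 and is
      nonempty, so \<open>c - 1\<close> is a true predecessor there.\<close>
    proof (cases "d = []")
      case True
      then show ?thesis
        using b(2) d e by (simp add: comp_sequence_singleton replicate_append_same)
    next
      case False
      then have "sum_list s \<in> {1..sum_list s}" using len d by (cases d) auto
      then have "0 < b ! sum_list s" using b(1) unfolding compositions_def by blast
      then have "0 < c" using len d by (simp add: nth_append)
      then have "replicate c (0::nat) = replicate (c - 1) 0 @ [0]"
        by (cases c) (auto simp: replicate_append_same)
      then show ?thesis using False b(2) d e by (simp add: comp_sequence_snoc)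
    qed
    ultimately show ?thesis by (metis image_eqI)
  qed
qed

section \<open>Lists adapted to a chain of sets\<close>

text \<open>
  For a flag \<open>X\<close> and a 0,1-sequence \<open>s\<close>, these are the permutations with rank sequence \<open>s\<close> and flag
  \<open>X\<close>; stated elementwise, they can be counted one entry of \<open>s\<close> at a time.
\<close>

definition adapted_lists :: "(nat \<Rightarrow> 'a set) \<Rightarrow> nat list \<Rightarrow> 'a list set" where
  "adapted_lists X s = {\<pi>. length \<pi> = length s \<and> distinct \<pi> \<and>
     (\<forall>i<length s. \<pi> ! i \<in> X (sum_list (take (Suc i) s)) \<and>
       (s ! i = 1 \<longrightarrow> \<pi> ! i \<notin> X (sum_list (take i s))))}"

lemma adapted_lists_Nil: "adapted_lists X [] = {[]}"
  by (auto simp: adapted_lists_def)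

lemma take_adapted_lists:
  assumes "\<pi> \<in> adapted_lists X (s @ t)"
  shows "take (length s) \<pi> \<in> adapted_lists X s"
proof -
  have "\<pi> ! i \<in> X (sum_list (take (Suc i) s)) \<and>
      (s ! i = 1 \<longrightarrow> \<pi> ! i \<notin> X (sum_list (take i s)))" if "i < length s" for i
    using assms that unfolding adapted_lists_def
    by (auto simp: nth_append dest!: spec[of _ i])
  then show ?thesis using assms by (auto simp: adapted_lists_def)
qed

text \<open>The conditions stop at \<open>r\<close> because the intended instance is
  \<open>nth Xs\<close> for a flag \<open>Xs\<close>, which is unspecified past the top
  flat.\<close>

locale finite_chain =
  fixes X :: "nat \<Rightarrow> 'a set" and r :: nat
  assumes chain_mono: "i \<le> j \<Longrightarrow> j \<le> r \<Longrightarrow> X i \<subseteq> X j"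
    and chain_finite: "j \<le> r \<Longrightarrow> finite (X j)"
begin

lemma set_adapted_lists:
  assumes "\<pi> \<in> adapted_lists X s" "sum_list s \<le> r"
  shows "set \<pi> \<subseteq> X (sum_list s)"
proof
  fix x assume "x \<in> set \<pi>"
  then obtain i where i: "i < length s" "x = \<pi> ! i"
    using assms(1) by (auto simp: in_set_conv_nth adapted_lists_def)
  have "sum_list (take (Suc i) s) \<le> sum_list s"
    by (metis append_take_drop_id le_add1 sum_list_append)
  then show "x \<in> X (sum_list s)"
    using chain_mono[of "sum_list (take (Suc i) s)" "sum_list s"] assms i
    by (auto simp: adapted_lists_def)
qed

lemma finite_adapted_lists:
  assumes "sum_list s \<le> r"
  shows "finite (adapted_lists X s)"
proof (rule finite_subset)
  show "adapted_lists X s \<subseteq> {\<pi>. set \<pi> \<subseteq> X (sum_list s) \<and> length \<pi> = length s}"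
    using set_adapted_lists assms by (auto simp: adapted_lists_def)
  show "finite {\<pi>. set \<pi> \<subseteq> X (sum_list s) \<and> length \<pi> = length s}"
    using chain_finite assms by (intro finite_lists_length_eq) auto
qed

text \<open>For an entry 1, avoiding \<open>X (sum_list s)\<close> already avoids
  \<open>set \<pi>\<close>, since \<open>set_adapted_lists\<close> puts the elements used so far
  inside that set.\<close>

lemma adapted_lists_snoc:
  assumes "sum_list s + e \<le> r" "e \<le> 1"
  shows "adapted_lists X (s @ [e]) = (\<lambda>(\<pi>, x). \<pi> @ [x]) `
    (SIGMA \<pi>:adapted_lists X s. X (sum_list s + e) - (if e = 1 then X (sum_list s) else set \<pi>))"
    (is "_ = ?R")
proof (intro set_eqI iffI)
  fix \<rho> assume \<rho>: "\<rho> \<in> adapted_lists X (s @ [e])"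
  then have "length \<rho> = Suc (length s)" by (simp add: adapted_lists_def)
  then obtain \<pi> x where \<pi>: "\<rho> = \<pi> @ [x]" "length \<pi> = length s"
    by (metis length_Suc_conv_rev)
  have "\<pi> ! i \<in> X (sum_list (take (Suc i) s)) \<and>
       (s ! i = 1 \<longrightarrow> \<pi> ! i \<notin> X (sum_list (take i s)))" if "i < length s" for i
    using \<rho> \<pi> that unfolding adapted_lists_def
    by (auto simp: nth_append dest!: spec[of _ i])
  then have "\<pi> \<in> adapted_lists X s" using \<rho> \<pi> by (auto simp: adapted_lists_def)
  moreover have "x \<in> X (sum_list s + e)" "e = 1 \<longrightarrow> x \<notin> X (sum_list s)" "x \<notin> set \<pi>"
    using \<rho> \<pi> unfolding adapted_lists_def
    by (auto simp: nth_append dest!: spec[of _ "length s"])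
  ultimately have "(\<pi>, x) \<in> (SIGMA \<pi>:adapted_lists X s.
      X (sum_list s + e) - (if e = 1 then X (sum_list s) else set \<pi>))"
    by simp
  then show "\<rho> \<in> ?R" unfolding \<pi>(1) by (rule rev_image_eqI) simp
next
  fix \<rho> assume "\<rho> \<in> ?R"
  then obtain \<pi> x where \<pi>: "\<rho> = \<pi> @ [x]" "\<pi> \<in> adapted_lists X s" "x \<in> X (sum_list s + e)"
    "x \<notin> (if e = 1 then X (sum_list s) else set \<pi>)" by auto
  then have "x \<notin> set \<pi>" using set_adapted_lists[of \<pi> s] assms by (auto split: if_splits)
  then show "\<rho> \<in> adapted_lists X (s @ [e])"
    using \<pi> by (auto simp: adapted_lists_def nth_append less_Suc_eq)
qed

lemma card_adapted_lists_snoc: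
  assumes "sum_list s + e \<le> r" "e \<le> 1"
  shows "card (adapted_lists X (s @ [e])) = card (adapted_lists X s) *
    (if e = 1 then card (X (Suc (sum_list s)) - X (sum_list s))
     else card (X (sum_list s)) - length s)"
proof -
  have inj: "inj_on (\<lambda>(\<pi>, x). \<pi> @ [x]) A" for A :: "('a list \<times> 'a) set"
    by (auto intro: inj_onI)
  have "card (adapted_lists X (s @ [e])) = (\<Sum>\<pi>\<in>adapted_lists X s.
      card (X (sum_list s + e) - (if e = 1 then X (sum_list s) else set \<pi>)))"
    unfolding adapted_lists_snoc[OF assms] card_image[OF inj]
    using finite_adapted_lists assms chain_finite by (subst card_SigmaI) auto
  also have "\<dots> = (\<Sum>\<pi>\<in>adapted_lists X s.
      if e = 1 then card (X (Suc (sum_list s)) - X (sum_list s))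
      else card (X (sum_list s)) - length s)"
  \<comment> \<open>The number of choices for the last element is the same for every \<pi>: its
    elements all lie in \<open>X (sum_list s)\<close>, and there are exactly \<open>length s\<close>
    of them.\<close>
  proof (rule sum.cong)
    fix \<pi> assume \<pi>: "\<pi> \<in> adapted_lists X s"
    then have "set \<pi> \<subseteq> X (sum_list s)" "card (set \<pi>) = length s"
      using set_adapted_lists assms distinct_card[of \<pi>] by (auto simp: adapted_lists_def)
    then show "card (X (sum_list s + e) - (if e = 1 then X (sum_list s) else set \<pi>)) =
      (if e = 1 then card (X (Suc (sum_list s)) - X (sum_list s))
       else card (X (sum_list s)) - length s)"
      using assms(2) by (cases "e = 1") (auto simp: card_Diff_subset le_Suc_eq)
  qed simp
  finally show ?thesis by simp
qed

lemma card_adapted_lists_zeros: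
  assumes "sum_list s \<le> r" "length s \<le> card (X (sum_list s))"
  shows "int (card (adapted_lists X (s @ replicate m 0))) =
    int (card (adapted_lists X s)) *
      falling_fact (int (card (X (sum_list s))) - int (length s)) m"
proof (induction m)
  case 0
  then show ?case by (simp add: falling_fact_def)
next
  case (Suc m)
  let ?t = "int (card (X (sum_list s))) - int (length s)"
  have "card (adapted_lists X (s @ replicate (Suc m) 0)) =
      card (adapted_lists X (s @ replicate m 0)) * (card (X (sum_list s)) - (length s + m))"
    using card_adapted_lists_snoc[of "s @ replicate m 0" 0] assms
    by (simp add: sum_list_replicate replicate_append_same)
  then have "int (card (adapted_lists X (s @ replicate (Suc m) 0))) =
      int (card (adapted_lists X s)) *
        (falling_fact ?t m * int (card (X (sum_list s)) - (length s + m)))"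
    using Suc.IH by simp
  also have "falling_fact ?t m * int (card (X (sum_list s)) - (length s + m)) =
      falling_fact ?t (Suc m)"
  \<comment> \<open>Once the elements have run out, the natural subtraction truncates to 0, and the
    falling factorial already contains a zero factor.\<close>
  proof (cases "length s + m \<le> card (X (sum_list s))")
    case True
    then show ?thesis by (simp add: falling_fact_Suc of_nat_diff algebra_simps)
  next
    case False
    then show ?thesis using falling_fact_eq_0[of ?t m] assms by (simp add: falling_fact_Suc)
  qed
  finally show ?case .
qed

lemma card_chain:
  assumes "card (X 0) = a ! 0" and "\<And>j. j < r \<Longrightarrow> card (X (Suc j) - X j) = a ! Suc j"
    and "j \<le> r"
  shows "card (X j) = (\<Sum>i\<le>j. a ! i)"
  using assms(3)
proof (induction j)
  case (Suc j)
  have "card (X (Suc j)) = card (X j) + card (X (Suc j) - X j)"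
    using chain_mono[of j "Suc j"] chain_finite[of j] chain_finite[of "Suc j"] Suc.prems
    by (simp add: card_Diff_subset card_mono)
  then show ?case using Suc assms(2)[of j] by simp
qed (simp add: assms(1))

text \<open>Induction over the blocks of \<open>b\<close>: the 1 of block \<open>j\<close> can be
  placed in \<open>a ! j\<close> ways, and its zeros contribute a falling factorial. The product is
  the coefficient of the symbol in \<open>gamma a\<close>.\<close>

lemma card_adapted_lists_comp_sequence:
  assumes card0: "card (X 0) = a ! 0"
    and card_Suc: "\<And>j. j < r \<Longrightarrow> card (X (Suc j) - X j) = a ! Suc j"
    and len: "length a = Suc r" and b: "b \<in> compositions n r" and dom: "b \<unrhd> a"
  shows "int (card (adapted_lists X (comp_sequence b))) =
    falling_fact (int (a ! 0)) (b ! 0) * (\<Prod>j=1..r. int (a ! j) *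
      falling_fact (int (a ! j) - 1 + (\<Sum>i<j. int (a ! i) - int (b ! i))) (b ! j - 1))"
proof -
  have lenb: "length b = Suc r" using b by (simp add: compositions_def)
  have posb: "0 < b ! j" if "0 < j" "j \<le> r" for j
    using b that by (simp add: compositions_def)
  note cardX = card_chain[of a, OF card0 card_Suc]
  have "int (card (adapted_lists X (comp_sequence (take (Suc k) b)))) =
    falling_fact (int (a ! 0)) (b ! 0) * (\<Prod>j=1..k. int (a ! j) *
      falling_fact (int (a ! j) - 1 + (\<Sum>i<j. int (a ! i) - int (b ! i))) (b ! j - 1))"
    if "k \<le> r" for k
    using that
  proof (induction k)
    case 0
    have "take (Suc 0) b = [b ! 0]" using lenb by (cases b) auto
    then show ?case
      using card_adapted_lists_zeros[of "[]" "b ! 0"] card0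
      by (simp add: comp_sequence_singleton adapted_lists_Nil)
  next
    case (Suc k)
    let ?s = "comp_sequence (take (Suc k) b)"
    have ne: "take (Suc k) b \<noteq> []" using lenb by auto
    have lens: "length ?s = (\<Sum>i\<le>k. b ! i)" and sums: "sum_list ?s = k"
      using comp_sequence_take[OF b, of k] Suc.prems by auto
    \<comment> \<open>\<open>card_adapted_lists_zeros\<close> asks that the prefix up to and
      including the new 1 fit into \<open>X (Suc k)\<close>. Dominance gives this, because block
      \<open>Suc k\<close> is nonempty.\<close>
    have "(\<Sum>i\<le>Suc k. b ! i) \<le> (\<Sum>i\<le>Suc k. a ! i)"
      using dom Suc.prems len unfolding comp_dominates_def by (metis less_Suc_eq_le)
    then have le: "Suc (length ?s) \<le> card (X (Suc k))"
      using posb[of "Suc k"] Suc.prems lens by (simp add: cardX)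
    have "comp_sequence (take (Suc (Suc k)) b) = (?s @ [1]) @ replicate (b ! Suc k - 1) 0"
      using lenb Suc.prems comp_sequence_snoc[OF ne] by (simp add: take_Suc_conv_app_nth[of "Suc k"])
    then have "int (card (adapted_lists X (comp_sequence (take (Suc (Suc k)) b)))) =
        int (card (adapted_lists X (?s @ [1]))) *
          falling_fact (int (card (X (Suc k))) - int (Suc (length ?s))) (b ! Suc k - 1)"
      using card_adapted_lists_zeros[of "?s @ [1]" "b ! Suc k - 1"] sums le Suc.prems by simp
    also have "card (adapted_lists X (?s @ [1])) = card (adapted_lists X ?s) * a ! Suc k"
      using card_adapted_lists_snoc[of ?s 1] sums Suc.prems card_Suc[of k] by simp
    also have "int (card (X (Suc k))) - int (Suc (length ?s)) =
        int (a ! Suc k) - 1 + (\<Sum>i<Suc k. int (a ! i) - int (b ! i))"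
      using Suc.prems
      by (simp add: cardX lens sum_subtractf lessThan_Suc_atMost)
    finally show ?case using Suc by (simp add: algebra_simps)
  qed
  from this[of r] show ?thesis using lenb by simp
qed

text \<open>The prefix made of blocks 0 to \<open>j\<close> consists of distinct elements of
  \<open>X j\<close>, so its length is at most \<open>card (X j)\<close>. Both numbers are partial
  sums.\<close>

lemma adapted_lists_comp_sequence_dominates:
  assumes card0: "card (X 0) = a ! 0"
    and card_Suc: "\<And>j. j < r \<Longrightarrow> card (X (Suc j) - X j) = a ! Suc j"
    and len: "length a = Suc r" and b: "b \<in> compositions n r"
    and \<pi>: "\<pi> \<in> adapted_lists X (comp_sequence b)"
  shows "b \<unrhd> a"
  unfolding comp_dominates_def
proof (intro conjI allI impI)
  have lenb: "length b = Suc r" using b by (simp add: compositions_def)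
  then show "length b = length a" using len by simp
  fix j assume "j < length a"
  then have j: "j \<le> r" using len by simp
  let ?s = "comp_sequence (take (Suc j) b)"
  have "take (Suc j) b \<noteq> []" using lenb by auto
  then obtain t where t: "comp_sequence b = ?s @ t"
    using comp_sequence_append[of "take (Suc j) b" "drop (Suc j) b"] by auto
  have "take (length ?s) \<pi> \<in> adapted_lists X ?s"
    using \<pi> unfolding t by (rule take_adapted_lists)
  then have "set (take (length ?s) \<pi>) \<subseteq> X j"
    using set_adapted_lists[of "take (length ?s) \<pi>" ?s] comp_sequence_take[OF b j] j by simp
  moreover have "card (set (take (length ?s) \<pi>)) = length ?s"
    using \<pi> t by (subst distinct_card) (auto simp: adapted_lists_def)
  ultimately have "length ?s \<le> card (X j)"
    using card_mono[OF chain_finite[OF j]] by metis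
  then show "(\<Sum>i\<le>j. b ! i) \<le> (\<Sum>i\<le>j. a ! i)"
    using comp_sequence_take[OF b j] card_chain[of a, OF card0 card_Suc j] by simp
qed

end

section \<open>The invariant in terms of flags\<close>

lemma length_flag_composition: "length (flag_composition Xs) = length Xs"
  by (simp add: flag_composition_def)

lemma nth_flag_composition_0: "Xs \<noteq> [] \<Longrightarrow> flag_composition Xs ! 0 = card (Xs ! 0)"
  by (simp add: flag_composition_def)

lemma nth_flag_composition_Suc:
  "Suc j < length Xs \<Longrightarrow> flag_composition Xs ! Suc j = card (Xs ! Suc j - Xs ! j)"
  by (simp add: flag_composition_def del: upt_Suc)

definition mclosure :: "'a set_system \<Rightarrow> 'a set \<Rightarrow> 'a set" where
  "mclosure M A = {x \<in> ground M. mrank M (insert x A) = mrank M A}"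

text \<open>Containment suffices: for a flag, a prefix inside the flat of its own rank has that flat
  as its closure, by \<open>mclosure_eq_flat\<close>.\<close>

definition follows_flag :: "'a set_system \<Rightarrow> 'a set list \<Rightarrow> 'a list \<Rightarrow> bool" where
  "follows_flag M Xs \<pi> \<longleftrightarrow>
     (\<forall>i\<le>length \<pi>. set (take i \<pi>) \<subseteq> Xs ! mrank M (set (take i \<pi>)))"

lemma take_rank_sequence: "take i (rank_sequence M \<pi>) = rank_sequence M (take i \<pi>)"
  by (auto simp: rank_sequence_def take_map min_def intro!: nth_equalityI)

section \<open>Rank, closure and flats\<close>

context matroid
begin

lemma mrank_insert_ge: "mrank M X \<le> mrank M (insert x X)"
  by (rule mrank_mono) auto

text \<open>Augmenting always from one maximum independent subset \<open>Y\<close> of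
  \<open>Z\<close> keeps the extension inside \<open>Z\<close>.\<close>

lemma indep_extend_within:
  assumes "A \<in> indeps M" "A \<subseteq> Z"
  shows "\<exists>B\<in>indeps M. A \<subseteq> B \<and> B \<subseteq> Z \<and> card B = mrank M Z"
proof -
  obtain Y where Y: "Y \<in> indeps M" "Y \<subseteq> Z" "card Y = mrank M Z" using mrank_witness by blast
  have "card A \<le> mrank M Z" using assms by (rule mrank_ge)
  moreover have "\<exists>B\<in>indeps M. A \<subseteq> B \<and> B \<subseteq> Z \<and> card B = k"
    if "card A \<le> k" "k \<le> mrank M Z" for k
    using that
  proof (induction k rule: dec_induct)
    case base
    then show ?case using assms by blast
  next
    case (step k)
    then obtain B where B: "B \<in> indeps M" "A \<subseteq> B" "B \<subseteq> Z" "card B = k" by auto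
    obtain y where "y \<in> Y - B" "insert y B \<in> indeps M"
      using indep_augment[OF B(1) Y(1)] B(4) Y(3) step by auto
    then show ?case using B Y finite_indep by (intro bexI[of _ "insert y B"]) auto
  qed
  ultimately show ?thesis by blast
qed

text \<open>A form of submodularity. A basis \<open>B\<close> of \<open>A\<close> extends to a basis
  \<open>C\<close> of \<open>Z\<close>; augmenting \<open>C\<close> from a basis of
  \<open>insert x Z\<close> can only add \<open>x\<close>, as any other element would give an
  independent subset of \<open>Z\<close> that is too large. Hence \<open>insert x B\<close> is
  independent as well.\<close>

lemma mrank_insert_less_antimono:
  assumes "A \<subseteq> Z" "mrank M Z < mrank M (insert x Z)"
  shows "mrank M A < mrank M (insert x A)"
proof -
  obtain B where B: "B \<in> indeps M" "B \<subseteq> A" "card B = mrank M A" using mrank_witness by blast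
  obtain C where C: "C \<in> indeps M" "B \<subseteq> C" "C \<subseteq> Z" "card C = mrank M Z"
    using indep_extend_within[OF B(1), of Z] B(2) assms(1) by auto
  obtain Y where Y: "Y \<in> indeps M" "Y \<subseteq> insert x Z" "card Y = mrank M (insert x Z)"
    using mrank_witness by blast
  obtain y where y: "y \<in> Y - C" "insert y C \<in> indeps M"
    using indep_augment[OF C(1) Y(1)] C(4) Y(3) assms(2) by auto
  have "y = x"
  proof (rule ccontr)
    assume "y \<noteq> x"
    then have "card (insert y C) \<le> mrank M Z" using y Y(2) C(3) by (intro mrank_ge) auto
    then show False using y C(1,4) finite_indep by simp
  qed
  then have "insert x B \<in> indeps M" "x \<notin> B"
    using indep_subset[OF y(2), of "insert x B"] y(1) C(2) by auto
  then have "Suc (card B) \<le> mrank M (insert x A)"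
    using mrank_ge[of "insert x B" "insert x A"] insert_mono[OF B(2)] finite_indep[OF B(1)] by simp
  then show ?thesis using B(3) by simp
qed

lemma subset_mclosure: "A \<subseteq> ground M \<Longrightarrow> A \<subseteq> mclosure M A"
  by (auto simp: mclosure_def insert_absorb)

text \<open>Were the rank larger, a basis of \<open>A\<close> could be augmented by an element of
  the closure, which would then raise the rank of \<open>A\<close>.\<close>

lemma mrank_mclosure:
  assumes "A \<subseteq> ground M"
  shows "mrank M (mclosure M A) = mrank M A"
proof (rule ccontr)
  assume "mrank M (mclosure M A) \<noteq> mrank M A"
  then have less: "mrank M A < mrank M (mclosure M A)"
    using mrank_mono[OF subset_mclosure[OF assms]] by simp
  obtain B where B: "B \<in> indeps M" "B \<subseteq> A" "card B = mrank M A" using mrank_witness by blast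
  obtain Y where Y: "Y \<in> indeps M" "Y \<subseteq> mclosure M A" "card Y = mrank M (mclosure M A)"
    using mrank_witness by blast
  obtain y where y: "y \<in> Y - B" "insert y B \<in> indeps M"
    using indep_augment[OF B(1) Y(1)] B(3) Y(3) less by auto
  have "card (insert y B) \<le> mrank M (insert y A)" using y B by (intro mrank_ge) auto
  moreover have "mrank M (insert y A) = mrank M A" using y Y by (auto simp: mclosure_def)
  ultimately show False using y B finite_indep by simp
qed

lemma is_flat_mclosure:
  assumes "A \<subseteq> ground M"
  shows "is_flat M (mclosure M A)"
  unfolding is_flat_def
proof (intro conjI ballI)
  show "mclosure M A \<subseteq> ground M" by (auto simp: mclosure_def)
  fix x assume "x \<in> ground M - mclosure M A"
  then have "mrank M A < mrank M (insert x A)"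
    using mrank_insert_ge[of A x] by (auto simp: mclosure_def)
  also have "\<dots> \<le> mrank M (insert x (mclosure M A))"
    using subset_mclosure[OF assms] by (intro mrank_mono) auto
  finally show "mrank M (mclosure M A) < mrank M (insert x (mclosure M A))"
    by (simp add: mrank_mclosure assms)
qed

text \<open>An element outside \<open>F\<close> raises the rank of \<open>F\<close>, hence that of
  \<open>A\<close> by \<open>mrank_insert_less_antimono\<close>. This pins down a flat from any
  spanning subset and gives the uniqueness of flags and of covers below.\<close>

lemma mclosure_eq_flat:
  assumes "is_flat M F" "A \<subseteq> F" "mrank M A = mrank M F"
  shows "mclosure M A = F"
proof (intro set_eqI iffI)
  fix x assume "x \<in> F"
  then have "mrank M (insert x A) \<le> mrank M A" "x \<in> ground M"
    using mrank_mono[of "insert x A" F] assms by (auto simp: is_flat_def)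
  then show "x \<in> mclosure M A"
    using mrank_insert_ge[of A x] by (auto simp: mclosure_def)
next
  fix x assume x: "x \<in> mclosure M A"
  show "x \<in> F"
  proof (rule ccontr)
    assume "x \<notin> F"
    then have "mrank M F < mrank M (insert x F)"
      using x assms(1) by (auto simp: is_flat_def mclosure_def)
    then show False
      using mrank_insert_less_antimono[OF assms(2), of x] x by (simp add: mclosure_def)
  qed
qed

lemma mclosure_mono:
  assumes "A \<subseteq> B"
  shows "mclosure M A \<subseteq> mclosure M B"
proof
  fix x assume x: "x \<in> mclosure M A"
  then have "\<not> mrank M B < mrank M (insert x B)"
    using mrank_insert_less_antimono[OF assms, of x] by (auto simp: mclosure_def)
  then show "x \<in> mclosure M B"
    using x mrank_insert_ge[of B x] by (auto simp: mclosure_def)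
qed

lemma flat_full_rank:
  assumes "is_flat M F" "mrank M F = mrank M (ground M)"
  shows "F = ground M"
proof -
  have "x \<in> F" if "x \<in> ground M" for x
  proof (rule ccontr)
    assume "x \<notin> F"
    then have "mrank M F < mrank M (insert x F)" using that assms by (auto simp: is_flat_def)
    moreover have "mrank M (insert x F) \<le> mrank M (ground M)"
      using that assms by (intro mrank_mono) (auto simp: is_flat_def)
    ultimately show False using assms(2) by simp
  qed
  then show ?thesis using assms(1) by (auto simp: is_flat_def)
qed

section \<open>Flags, rank sequences and adapted lists\<close>

lemma flags_finite_chain:
  assumes "Xs \<in> flags M"
  shows "finite_chain (nth Xs) (mrank M (ground M))"
proof
  fix i j assume "i \<le> j" "j \<le> mrank M (ground M)"
  then show "Xs ! i \<subseteq> Xs ! j"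
  proof (induction j rule: dec_induct)
    case (step k)
    then have "Xs ! k \<subset> Xs ! Suc k" using assms by (simp add: flags_def)
    then show ?case using step by auto
  qed simp
next
  fix j assume "j \<le> mrank M (ground M)"
  then have "is_flat M (Xs ! j)" using assms by (simp add: flags_def)
  then show "finite (Xs ! j)" using finite_ground by (auto simp: is_flat_def intro: finite_subset)
qed

lemma flag_composition_in_compositions:
  assumes "Xs \<in> flags M"
  shows "flag_composition Xs \<in> compositions (card (ground M)) (mrank M (ground M))"
proof -
  interpret finite_chain "nth Xs" "mrank M (ground M)" using assms by (rule flags_finite_chain)
  let ?r = "mrank M (ground M)" and ?a = "flag_composition Xs"
  have len: "length Xs = Suc ?r" and top: "Xs ! ?r = ground M"
    using assms by (auto simp: flags_def)
  have "0 < ?a ! j" if "j \<in> {1..?r}" for j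
  proof -
    obtain i where i: "j = Suc i" using \<open>j \<in> {1..?r}\<close> by (cases j) auto
    then have "Xs ! i \<subset> Xs ! j" "finite (Xs ! j)"
      using that assms chain_finite[of j] by (auto simp: flags_def)
    then show ?thesis using i that len by (auto simp: nth_flag_composition_Suc card_gt_0_iff)
  qed
  moreover have "card (Xs ! ?r) = (\<Sum>i\<le>?r. ?a ! i)"
  proof (rule card_chain)
    show "card (Xs ! 0) = ?a ! 0" using len by (subst nth_flag_composition_0) auto
    show "card (Xs ! Suc j - Xs ! j) = ?a ! Suc j" if "j < ?r" for j
      using len that by (simp add: nth_flag_composition_Suc)
  qed simp
  ultimately show ?thesis
    using len top by (simp add: compositions_def length_flag_composition sum_list_sum_nth
      atLeast0LessThan lessThan_Suc_atMost)
qed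

lemma sum_list_rank_sequence: "sum_list (rank_sequence M \<pi>) = mrank M (set \<pi>)"
proof -
  let ?f = "\<lambda>j. mrank M (set (take j \<pi>))"
  have le: "?f j \<le> ?f (Suc j)" for j
    by (intro mrank_mono set_take_subset_set_take) simp
  have "(\<Sum>j<k. ?f (Suc j) - ?f j) = ?f k" for k
    using le by (induction k) (auto simp: mrank_empty)
  then show ?thesis
    by (simp add: rank_sequence_def interv_sum_list_conv_sum_set_nat atLeast0LessThan)
qed

lemma set_rank_sequence: "set (rank_sequence M \<pi>) \<subseteq> {0, 1}"
proof -
  have "mrank M (set (take (Suc j) \<pi>)) - mrank M (set (take j \<pi>)) \<in> {0, 1}"
    if "j < length \<pi>" for j
    using mrank_insert_le[of "\<pi> ! j" "set (take j \<pi>)"] that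
    by (auto simp: take_Suc_conv_app_nth)
  then show ?thesis by (simp add: rank_sequence_def image_subset_iff del: insert_iff)
qed

text \<open>In an adapted list the rank of each prefix is its number of ones. It is at most that,
  since the prefix lies in a flat of that rank; it is at least that, since an element placed at a 1
  lies outside a flat containing the earlier elements and so raises the rank.\<close>

lemma adapted_lists_flag:
  assumes Xs: "Xs \<in> flags M"
    and s: "length s = card (ground M)" "sum_list s = mrank M (ground M)" "set s \<subseteq> {0, 1}"
  shows "adapted_lists (nth Xs) s = {\<pi> \<in> permutations_of_set (ground M).
    follows_flag M Xs \<pi> \<and> rank_sequence M \<pi> = s}"
proof (intro set_eqI iffI)
  interpret finite_chain "nth Xs" "mrank M (ground M)" using Xs by (rule flags_finite_chain)
  fix \<pi> assume \<pi>: "\<pi> \<in> adapted_lists (nth Xs) s"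
  let ?\<sigma> = "\<lambda>i. sum_list (take i s)"
  have \<sigma>_le: "?\<sigma> i \<le> mrank M (ground M)" for i
    unfolding s(2)[symmetric] by (metis append_take_drop_id le_add1 sum_list_append)
  have flat: "is_flat M (Xs ! j)" "mrank M (Xs ! j) = j" if "j \<le> mrank M (ground M)" for j
    using Xs that by (auto simp: flags_def)
  have len: "length \<pi> = length s" "distinct \<pi>" using \<pi> by (auto simp: adapted_lists_def)
  have "set \<pi> \<subseteq> ground M"
    using set_adapted_lists[OF \<pi>] s(2) Xs by (simp add: flags_def)
  \<comment> \<open>The list has as many distinct entries as the ground set, so it is a permutation
    of it.\<close>
  then have set\<pi>: "set \<pi> = ground M"
    using card_seteq[OF finite_ground] distinct_card[OF len(2)] len(1) s(1) by simp
  have pre: "set (take i \<pi>) \<subseteq> Xs ! ?\<sigma> i \<and> mrank M (set (take i \<pi>)) = ?\<sigma> i"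
    if "i \<le> length s" for i
    using that
  proof (induction i)
    case 0
    then show ?case by (simp add: mrank_empty)
  next
    case (Suc i)
    then have IH: "set (take i \<pi>) \<subseteq> Xs ! ?\<sigma> i" "mrank M (set (take i \<pi>)) = ?\<sigma> i"
      and i: "i < length s" by auto
    have take: "set (take (Suc i) \<pi>) = insert (\<pi> ! i) (set (take i \<pi>))"
      using i len by (simp add: take_Suc_conv_app_nth)
    have \<sigma>: "?\<sigma> (Suc i) = ?\<sigma> i + s ! i" using i by (simp add: take_Suc_conv_app_nth)
    have "Xs ! ?\<sigma> i \<subseteq> Xs ! ?\<sigma> (Suc i)"
      using \<sigma> \<sigma>_le[of "Suc i"] by (intro chain_mono) auto
    moreover have "\<pi> ! i \<in> Xs ! ?\<sigma> (Suc i)" using \<pi> i by (auto simp: adapted_lists_def)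
    ultimately have sub: "set (take (Suc i) \<pi>) \<subseteq> Xs ! ?\<sigma> (Suc i)" using IH take by auto
    have upper: "mrank M (set (take (Suc i) \<pi>)) \<le> ?\<sigma> (Suc i)"
      using mrank_mono[OF sub] flat(2)[OF \<sigma>_le] by simp
    have "s ! i \<in> {0, 1}" using s(3) nth_mem[OF i] by blast
    then have "?\<sigma> (Suc i) \<le> mrank M (set (take (Suc i) \<pi>))"
    proof (elim insertE emptyE)
      assume "s ! i = 0"
      then show ?thesis using \<sigma> IH take mrank_mono[of "set (take i \<pi>)" "set (take (Suc i) \<pi>)"] by auto
    next
      assume one: "s ! i = 1"
      then have "\<pi> ! i \<notin> Xs ! ?\<sigma> i" using \<pi> i by (auto simp: adapted_lists_def)
      moreover have "\<pi> ! i \<in> ground M" using set\<pi> i len nth_mem[of i \<pi>] by auto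
      ultimately have "mrank M (Xs ! ?\<sigma> i) < mrank M (insert (\<pi> ! i) (Xs ! ?\<sigma> i))"
        using flat(1)[OF \<sigma>_le[of i]] by (auto simp: is_flat_def)
      then have "mrank M (set (take i \<pi>)) < mrank M (set (take (Suc i) \<pi>))"
        unfolding take by (rule mrank_insert_less_antimono[OF IH(1)])
      then show ?thesis using IH \<sigma> one by simp
    qed
    then show ?case using sub upper by simp
  qed
  have "rank_sequence M \<pi> = s"
  proof (rule nth_equalityI)
    fix i assume "i < length (rank_sequence M \<pi>)"
    then have i: "i < length s" using len by (simp add: rank_sequence_def)
    then have "rank_sequence M \<pi> ! i = ?\<sigma> (Suc i) - ?\<sigma> i"
      using pre[of i] pre[of "Suc i"] len by (simp add: rank_sequence_def)
    then show "rank_sequence M \<pi> ! i = s ! i" using i by (simp add: take_Suc_conv_app_nth)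
  qed (simp add: rank_sequence_def len)
  then show "\<pi> \<in> {\<pi> \<in> permutations_of_set (ground M).
      follows_flag M Xs \<pi> \<and> rank_sequence M \<pi> = s}"
    using pre len set\<pi> by (auto simp: permutations_of_set_def follows_flag_def)
next
  fix \<pi> assume "\<pi> \<in> {\<pi> \<in> permutations_of_set (ground M).
      follows_flag M Xs \<pi> \<and> rank_sequence M \<pi> = s}"
  then have \<pi>: "set \<pi> = ground M" "distinct \<pi>" "follows_flag M Xs \<pi>" "rank_sequence M \<pi> = s"
    by (auto simp: permutations_of_set_def)
  have len: "length \<pi> = length s" using \<pi>(4) by (auto simp: rank_sequence_def)
  have \<sigma>: "sum_list (take i s) = mrank M (set (take i \<pi>))" for i
    unfolding \<pi>(4)[symmetric] take_rank_sequence by (rule sum_list_rank_sequence)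
  have sub: "set (take i \<pi>) \<subseteq> Xs ! sum_list (take i s)" if "i \<le> length s" for i
    using \<pi>(3) that len \<sigma> by (simp add: follows_flag_def)
  have "\<pi> ! i \<in> Xs ! sum_list (take (Suc i) s) \<and>
      (s ! i = 1 \<longrightarrow> \<pi> ! i \<notin> Xs ! sum_list (take i s))" if i: "i < length s" for i
  proof (intro conjI impI notI)
    have take: "set (take (Suc i) \<pi>) = insert (\<pi> ! i) (set (take i \<pi>))"
      using i len by (simp add: take_Suc_conv_app_nth)
    then show "\<pi> ! i \<in> Xs ! sum_list (take (Suc i) s)" using sub[of "Suc i"] i by auto
    \<comment> \<open>If the new element stayed in the old flat, the longer prefix could not exceed
      the rank of that flat, although the entry 1 says that the rank rises.\<close>
    assume one: "s ! i = 1" and "\<pi> ! i \<in> Xs ! sum_list (take i s)"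
    then have "set (take (Suc i) \<pi>) \<subseteq> Xs ! sum_list (take i s)" using take sub[of i] i by auto
    then have "sum_list (take (Suc i) s) \<le> mrank M (Xs ! sum_list (take i s))"
      unfolding \<sigma>[of "Suc i"] by (rule mrank_mono)
    moreover have "sum_list (take i s) \<le> mrank M (ground M)"
      unfolding \<sigma> \<pi>(1)[symmetric] by (intro mrank_mono set_take_subset)
    ultimately have "sum_list (take (Suc i) s) \<le> sum_list (take i s)"
      using Xs by (simp add: flags_def)
    then show False using one i by (simp add: take_Suc_conv_app_nth)
  qed
  then show "\<pi> \<in> adapted_lists (nth Xs) s" using len \<pi>(2) by (simp add: adapted_lists_def)
qed

text \<open>A discrete intermediate value argument: one more element raises the rank by at most
  1.\<close>

lemma rank_prefix_exists:
  "k \<le> mrank M (set \<pi>) \<Longrightarrow> \<exists>i\<le>length \<pi>. mrank M (set (take i \<pi>)) = k"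
proof (induction \<pi> rule: rev_induct)
  case Nil
  then show ?case by (simp add: mrank_empty)
next
  case (snoc x \<pi>)
  show ?case
  proof (cases "k \<le> mrank M (set \<pi>)")
    case True
    then obtain i where "i \<le> length \<pi>" "mrank M (set (take i \<pi>)) = k" using snoc.IH by blast
    then show ?thesis by (intro exI[of _ i]) simp
  next
    case False
    then have "k = mrank M (set (\<pi> @ [x]))"
      using snoc.prems mrank_insert_le[of x "set \<pi>"] by simp
    then show ?thesis by (intro exI[of _ "Suc (length \<pi>)"]) simp
  qed
qed

text \<open>The flat of rank \<open>k\<close> must be the closure of a prefix of rank
  \<open>k\<close>; \<open>p k\<close> is the length of some such prefix.\<close>

lemma ex1_followed_flag:
  assumes "\<pi> \<in> permutations_of_set (ground M)"
  shows "\<exists>!Xs. Xs \<in> flags M \<and> follows_flag M Xs \<pi>"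
proof -
  let ?r = "mrank M (ground M)"
  have set\<pi>: "set \<pi> = ground M" using assms by (simp add: permutations_of_set_def)
  have "\<forall>k. \<exists>i. k \<le> ?r \<longrightarrow> i \<le> length \<pi> \<and> mrank M (set (take i \<pi>)) = k"
    using rank_prefix_exists[of _ \<pi>] set\<pi> by auto
  then obtain p where p: "\<And>k. k \<le> ?r \<Longrightarrow> p k \<le> length \<pi> \<and> mrank M (set (take (p k) \<pi>)) = k"
    by metis
  have sub: "set (take i \<pi>) \<subseteq> ground M" for i
    using set_take_subset[of i \<pi>] set\<pi> by simp
  define F where "F k = mclosure M (set (take (p k) \<pi>))" for k
  have flat: "is_flat M (F k)" for k unfolding F_def by (rule is_flat_mclosure[OF sub])
  have rank: "mrank M (F k) = k" if "k \<le> ?r" for k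
    unfolding F_def mrank_mclosure[OF sub] using p that by simp
  have mono: "F k \<subset> F (Suc k)" if "Suc k \<le> ?r" for k
  proof -
    \<comment> \<open>The lengths \<open>p k\<close> are chosen independently, but a longer prefix
      cannot have smaller rank, so they increase with \<open>k\<close>.\<close>
    have "p k \<le> p (Suc k)"
    proof (rule ccontr)
      assume "\<not> p k \<le> p (Suc k)"
      then have "mrank M (set (take (p (Suc k)) \<pi>)) \<le> mrank M (set (take (p k) \<pi>))"
        by (intro mrank_mono set_take_subset_set_take) simp
      then show False using p[of k] p[of "Suc k"] that by simp
    qed
    then have "F k \<subseteq> F (Suc k)"
      unfolding F_def by (intro mclosure_mono set_take_subset_set_take)
    moreover have "F k \<noteq> F (Suc k)" using rank[of k] rank[of "Suc k"] that by auto
    ultimately show ?thesis by blast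
  qed
  have top: "F ?r = ground M" using flat rank by (intro flat_full_rank) auto
  let ?Xs = "map F [0..<Suc ?r]"
  have nth: "?Xs ! k = F k" if "k \<le> ?r" for k using that by (simp del: upt_Suc)
  have "?Xs \<in> flags M"
    unfolding flags_def using flat rank mono top nth by (auto simp del: upt_Suc)
  moreover have "follows_flag M ?Xs \<pi>"
    unfolding follows_flag_def
  proof (intro allI impI)
    fix i
    let ?k = "mrank M (set (take i \<pi>))"
    have k: "?k \<le> ?r" by (intro mrank_mono sub)
    have "set (take i \<pi>) \<subseteq> F ?k"
    \<comment> \<open>Prefixes \<open>i\<close> and \<open>p ?k\<close> have equal rank. The shorter
      case is containment; in the longer case no element of prefix \<open>i\<close> raises the rank
      of prefix \<open>p ?k\<close>.\<close>
    proof (cases "i \<le> p ?k")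
      case True
      then show ?thesis
        using set_take_subset_set_take[OF True, of \<pi>] subset_mclosure[OF sub[of "p ?k"]]
        by (auto simp: F_def)
    next
      case False
      then have le: "set (take (p ?k) \<pi>) \<subseteq> set (take i \<pi>)"
        by (intro set_take_subset_set_take) simp
      show ?thesis
      proof
        fix x assume x: "x \<in> set (take i \<pi>)"
        then have "mrank M (insert x (set (take (p ?k) \<pi>))) \<le> ?k"
          using le by (intro mrank_mono) auto
        moreover have "?k \<le> mrank M (insert x (set (take (p ?k) \<pi>)))"
          using mrank_insert_ge[of "set (take (p ?k) \<pi>)" x] p[OF k] by simp
        ultimately show "x \<in> F ?k" using x sub p[OF k] by (auto simp: F_def mclosure_def)
      qed
    qed
    then show "set (take i \<pi>) \<subseteq> ?Xs ! ?k" using nth[OF k] by simp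
  qed
  moreover have "Ys = ?Xs" if "Ys \<in> flags M" "follows_flag M Ys \<pi>" for Ys
  proof (rule nth_equalityI)
    show len: "length Ys = length ?Xs" using that by (simp add: flags_def)
    fix k assume "k < length Ys"
    then have k: "k \<le> ?r" using len by simp
    have "set (take (p k) \<pi>) \<subseteq> Ys ! k" using that(2) p[OF k] unfolding follows_flag_def by metis
    then have "mclosure M (set (take (p k) \<pi>)) = Ys ! k"
      using that(1) p[OF k] k by (intro mclosure_eq_flat) (auto simp: flags_def)
    then show "Ys ! k = ?Xs ! k" using nth[OF k] by (simp add: F_def)
  qed
  ultimately show ?thesis by blast
qed

text \<open>The permutations that follow the flag are grouped by rank sequence. Each group is a set
  of adapted lists, whose size is the coefficient in \<open>gamma\<close>.\<close>

lemma gamma_flag_composition: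
  assumes Xs: "Xs \<in> flags M"
  shows "(gamma (flag_composition Xs) :: nat list \<Rightarrow>\<^sub>0 'k::field_char_0) =
    (\<Sum>\<pi>\<in>{\<pi> \<in> permutations_of_set (ground M). follows_flag M Xs \<pi>}.
      symbol (rank_sequence M \<pi>))"
proof -
  interpret V: vector_space "scale :: 'k \<Rightarrow> _" by (rule vector_space_scale)
  interpret finite_chain "nth Xs" "mrank M (ground M)" using Xs by (rule flags_finite_chain)
  let ?r = "mrank M (ground M)" and ?n = "card (ground M)" and ?a = "flag_composition Xs"
  let ?P = "{\<pi> \<in> permutations_of_set (ground M). follows_flag M Xs \<pi>}"
  let ?B = "compositions ?n ?r"
  have lenXs: "length Xs = Suc ?r" using Xs by (simp add: flags_def)
  have a: "length ?a = Suc ?r" "sum_list ?a = ?n"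
    using flag_composition_in_compositions[OF Xs] by (auto simp: compositions_def)
  have card0: "card (Xs ! 0) = ?a ! 0" using lenXs by (subst nth_flag_composition_0) auto
  have card_Suc: "card (Xs ! Suc j - Xs ! j) = ?a ! Suc j" if "j < ?r" for j
    using lenXs that by (simp add: nth_flag_composition_Suc)
  have adapted: "adapted_lists (nth Xs) (comp_sequence b) =
      {\<pi> \<in> ?P. rank_sequence M \<pi> = comp_sequence b}" if "b \<in> ?B" for b
  proof -
    have len: "length b = Suc ?r" using that by (simp add: compositions_def)
    have "length (comp_sequence b) = ?n" 
      using that by (subst length_comp_sequence) (auto simp: compositions_def)
    moreover have "sum_list (comp_sequence b) = ?r"
      using len by (subst sum_list_comp_sequence) auto
    ultimately show ?thesis
      using adapted_lists_flag[OF Xs _ _ set_comp_sequence] by auto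
  qed
  have "(\<Sum>\<pi>\<in>?P. symbol (rank_sequence M \<pi>) :: nat list \<Rightarrow>\<^sub>0 'k) =
      (\<Sum>s\<in>comp_sequence ` ?B. \<Sum>\<pi>\<in>{\<pi> \<in> ?P. rank_sequence M \<pi> = s}. symbol (rank_sequence M \<pi>))"
  proof (rule sum.group[symmetric])
    show "rank_sequence M ` ?P \<subseteq> comp_sequence ` ?B"
    proof (rule image_subsetI)
      fix \<pi> assume "\<pi> \<in> ?P"
      then have "length \<pi> = ?n" "set \<pi> = ground M"
        using distinct_card[of \<pi>] by (auto simp: permutations_of_set_def)
      then show "rank_sequence M \<pi> \<in> comp_sequence ` ?B"
        using comp_sequence_in_image[OF set_rank_sequence[of \<pi>]]
        by (simp add: sum_list_rank_sequence) (simp add: rank_sequence_def)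
    qed
  qed (auto simp: finite_compositions)
  also have "\<dots> = (\<Sum>b\<in>?B. \<Sum>\<pi>\<in>{\<pi> \<in> ?P. rank_sequence M \<pi> = comp_sequence b}.
      symbol (rank_sequence M \<pi>))"
    by (subst sum.reindex[OF inj_on_comp_sequence]) simp
  also have "\<dots> = (\<Sum>b\<in>?B. scale (of_nat (card (adapted_lists (nth Xs) (comp_sequence b))))
      (symbol (comp_sequence b)))"
  proof (rule sum.cong)
    fix b assume b: "b \<in> ?B"
    have "(\<Sum>\<pi>\<in>{\<pi> \<in> ?P. rank_sequence M \<pi> = comp_sequence b}. symbol (rank_sequence M \<pi>)) =
        (\<Sum>\<pi>\<in>adapted_lists (nth Xs) (comp_sequence b).
          scale (1::'k) (symbol (comp_sequence b)))"
      unfolding adapted[OF b] by (rule sum.cong) auto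
    also have "\<dots> = scale (\<Sum>\<pi>\<in>adapted_lists (nth Xs) (comp_sequence b). 1)
        (symbol (comp_sequence b))"
      by (rule V.scale_sum_left[symmetric])
    finally show "(\<Sum>\<pi>\<in>{\<pi> \<in> ?P. rank_sequence M \<pi> = comp_sequence b}.
        symbol (rank_sequence M \<pi>)) =
      scale (of_nat (card (adapted_lists (nth Xs) (comp_sequence b))) :: 'k)
        (symbol (comp_sequence b))"
      by simp
  qed simp
  also have "\<dots> = (\<Sum>b\<in>{b \<in> ?B. b \<unrhd> ?a}.
      scale (of_nat (card (adapted_lists (nth Xs) (comp_sequence b)))) (symbol (comp_sequence b)))"
  \<comment> \<open>\<open>gamma\<close> sums over dominating compositions only; the others admit no
    adapted list and contribute 0.\<close>
  proof (rule sum.mono_neutral_right)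
    show "\<forall>b\<in>?B - {b \<in> ?B. b \<unrhd> ?a}.
        scale (of_nat (card (adapted_lists (nth Xs) (comp_sequence b))) :: 'k)
          (symbol (comp_sequence b)) = 0"
    proof
      fix b assume b: "b \<in> ?B - {b \<in> ?B. b \<unrhd> ?a}"
      then have "adapted_lists (nth Xs) (comp_sequence b) = {}"
        using adapted_lists_comp_sequence_dominates[OF card0 card_Suc a(1)] by blast
      then show "scale (of_nat (card (adapted_lists (nth Xs) (comp_sequence b))) :: 'k)
          (symbol (comp_sequence b)) = 0"
        by simp
    qed
  qed (auto simp: finite_compositions)
  also have "\<dots> = gamma ?a"
    unfolding gamma_def a(2) a(1) diff_Suc_1
  proof (rule sum.cong)
    fix b assume "b \<in> {b \<in> ?B. b \<unrhd> ?a}"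
    then have "int (card (adapted_lists (nth Xs) (comp_sequence b))) =
      falling_fact (int (?a ! 0)) (b ! 0) * (\<Prod>j=1..?r. int (?a ! j) *
        falling_fact (int (?a ! j) - 1 + (\<Sum>i<j. int (?a ! i) - int (b ! i))) (b ! j - 1))"
      by (intro card_adapted_lists_comp_sequence card0 card_Suc a(1)) auto
    from arg_cong[OF this, of "of_int :: int \<Rightarrow> 'k"]
    show "scale (of_nat (card (adapted_lists (nth Xs) (comp_sequence b))) :: 'k)
        (symbol (comp_sequence b)) =
      scale (of_int (falling_fact (int (?a ! 0)) (b ! 0) * (\<Prod>j=1..?r. int (?a ! j) *
        falling_fact (int (?a ! j) - 1 + (\<Sum>i<j. int (?a ! i) - int (b ! i))) (b ! j - 1))))
        (symbol (comp_sequence b))"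
      by (simp only: of_int_of_nat_eq)
  qed simp
  finally show ?thesis by simp
qed

text \<open>Every permutation follows exactly one flag, so the sum over permutations splits over
  flags, and the part of a flag depends only on its composition.\<close>

theorem G_inv_eq_sum_gamma:
  "(G_inv M :: nat list \<Rightarrow>\<^sub>0 'k::field_char_0) =
    (\<Sum>a\<in>compositions (card (ground M)) (mrank M (ground M)). scale (of_nat (nu M a)) (gamma a))"
proof -
  interpret V: vector_space "scale :: 'k \<Rightarrow> _" by (rule vector_space_scale)
  let ?P = "permutations_of_set (ground M)"
  have "(G_inv M :: nat list \<Rightarrow>\<^sub>0 'k) =
      (\<Sum>\<pi>\<in>?P. \<Sum>Xs\<in>{Xs \<in> flags M. follows_flag M Xs \<pi>}. symbol (rank_sequence M \<pi>))"
    unfolding G_inv_def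
  proof (rule sum.cong)
    fix \<pi> assume "\<pi> \<in> ?P"
    then obtain Xs where "{Xs \<in> flags M. follows_flag M Xs \<pi>} = {Xs}"
      using ex1_followed_flag[of \<pi>] by blast
    then show "(symbol (rank_sequence M \<pi>) :: nat list \<Rightarrow>\<^sub>0 'k) =
        (\<Sum>Xs\<in>{Xs \<in> flags M. follows_flag M Xs \<pi>}. symbol (rank_sequence M \<pi>))"
      by simp
  qed simp
  also have "\<dots> = (\<Sum>Xs\<in>flags M. \<Sum>\<pi>\<in>{\<pi> \<in> ?P. follows_flag M Xs \<pi>}. symbol (rank_sequence M \<pi>))"
    using finite_flags by (intro sum.swap_restrict) auto
  also have "\<dots> = (\<Sum>Xs\<in>flags M. gamma (flag_composition Xs))"
    by (simp add: gamma_flag_composition)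
  also have "\<dots> = (\<Sum>a\<in>compositions (card (ground M)) (mrank M (ground M)).
      \<Sum>Xs\<in>{Xs \<in> flags M. flag_composition Xs = a}. gamma (flag_composition Xs))"
    using finite_flags finite_compositions flag_composition_in_compositions
    by (intro sum.group[symmetric]) auto
  also have "\<dots> = (\<Sum>a\<in>compositions (card (ground M)) (mrank M (ground M)).
      scale (of_nat (nu M a)) (gamma a))"
  proof (rule sum.cong)
    fix a
    have "(\<Sum>Xs\<in>{Xs \<in> flags M. flag_composition Xs = a}. gamma (flag_composition Xs)) =
        (\<Sum>Xs\<in>{Xs \<in> flags M. flag_composition Xs = a}. scale (1::'k) (gamma a))"
      by (rule sum.cong) auto
    also have "\<dots> = scale (\<Sum>Xs\<in>{Xs \<in> flags M. flag_composition Xs = a}. 1) (gamma a)"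
      by (rule V.scale_sum_left[symmetric])
    finally show "(\<Sum>Xs\<in>{Xs \<in> flags M. flag_composition Xs = a}. gamma (flag_composition Xs)) =
        scale (of_nat (nu M a) :: 'k) (gamma a)"
      by (simp add: nu_def)
  qed simp
  finally show ?thesis .
qed

end

section \<open>Truncation\<close>

lemma flag_composition_snoc:
  assumes "Ys \<noteq> []"
  shows "flag_composition (Ys @ [H]) = flag_composition Ys @ [card (H - last Ys)]"
proof (rule nth_equalityI)
  fix j assume "j < length (flag_composition (Ys @ [H]))"
  then have j: "j < length Ys \<or> j = length Ys" by (auto simp: length_flag_composition)
  show "flag_composition (Ys @ [H]) ! j = (flag_composition Ys @ [card (H - last Ys)]) ! j"
  proof (cases j)
    case 0
    then show ?thesis
      using assms by (simp add: nth_append length_flag_composition nth_flag_composition_0)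
  next
    case (Suc i)
    have "last Ys = Ys ! i" if "Suc i = length Ys"
      using that assms by (metis diff_Suc_1 last_conv_nth)
    moreover have "flag_composition (Ys @ [H]) ! Suc i = card ((Ys @ [H]) ! Suc i - (Ys @ [H]) ! i)"
      using j Suc by (intro nth_flag_composition_Suc) auto
    ultimately show ?thesis
      using j Suc by (auto simp: nth_append length_flag_composition nth_flag_composition_Suc)
  qed
qed (simp add: length_flag_composition)

text \<open>Nothing is required at the top, so that \<open>M\<close> and \<open>Trun M\<close> can
  share their lower flats.\<close>

definition partial_flags :: "'a set_system \<Rightarrow> nat \<Rightarrow> 'a set list set" where
  "partial_flags M k = {Ys. length Ys = k \<and> (\<forall>j<k. is_flat M (Ys ! j) \<and> mrank M (Ys ! j) = j) \<and>
     (\<forall>j. Suc j < k \<longrightarrow> Ys ! j \<subset> Ys ! Suc j)}"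

definition flat_covers :: "'a set_system \<Rightarrow> 'a set \<Rightarrow> 'a set set" where
  "flat_covers M X = {H. is_flat M H \<and> mrank M H = Suc (mrank M X) \<and> X \<subset> H}"

lemma partial_flags_Suc:
  assumes "0 < k"
  shows "partial_flags M (Suc k) =
    (\<lambda>(Ys, H). Ys @ [H]) ` (SIGMA Ys:partial_flags M k. flat_covers M (last Ys))"
proof (intro set_eqI iffI)
  fix Xs assume Xs: "Xs \<in> partial_flags M (Suc k)"
  then have "length Xs = Suc k" by (simp add: partial_flags_def)
  then obtain Ys H where YH: "Xs = Ys @ [H]" "length Ys = k" by (metis length_Suc_conv_rev)
  have "is_flat M (Ys ! j) \<and> mrank M (Ys ! j) = j" if "j < k" for j
    using Xs YH that unfolding partial_flags_def by (auto simp: nth_append dest!: spec[of _ j])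
  moreover have "Ys ! j \<subset> Ys ! Suc j" if "Suc j < k" for j
    using Xs YH that unfolding partial_flags_def by (auto simp: nth_append dest!: spec[of _ j])
  ultimately have "Ys \<in> partial_flags M k" using YH by (simp add: partial_flags_def)
  moreover obtain m where m: "k = Suc m" using assms by (cases k) auto
  moreover have "last Ys = Ys ! m" using YH m by (metis diff_Suc_1 last_conv_nth list.size(3) nat.distinct(1))
  moreover have "Xs ! m \<subset> Xs ! k" "is_flat M (Xs ! k)" "mrank M (Xs ! k) = k" "mrank M (Xs ! m) = m"
    using Xs m by (auto simp: partial_flags_def)
  then have "Ys ! m \<subset> H" "is_flat M H" "mrank M H = k" "mrank M (Ys ! m) = m"
    using YH m by (auto simp: nth_append)
  ultimately have "(Ys, H) \<in> (SIGMA Ys:partial_flags M k. flat_covers M (last Ys))"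
    by (simp add: flat_covers_def)
  then show "Xs \<in> (\<lambda>(Ys, H). Ys @ [H]) ` (SIGMA Ys:partial_flags M k. flat_covers M (last Ys))"
    unfolding YH(1) by (rule rev_image_eqI) simp
next
  fix Xs assume "Xs \<in> (\<lambda>(Ys, H). Ys @ [H]) ` (SIGMA Ys:partial_flags M k. flat_covers M (last Ys))"
  then obtain Ys H where YH: "Xs = Ys @ [H]" "Ys \<in> partial_flags M k" "H \<in> flat_covers M (last Ys)"
    by auto
  then have "length Ys = k" by (simp add: partial_flags_def)
  moreover have "last Ys = Ys ! (k - 1)"
    using calculation assms by (metis last_conv_nth length_greater_0_conv)
  moreover have "Suc j = k \<Longrightarrow> k - 1 = j" for j by simp
  ultimately show "Xs \<in> partial_flags M (Suc k)"
    using YH assms by (auto simp: partial_flags_def flat_covers_def nth_append less_Suc_eq)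
qed

section \<open>Rank, flats and partial flags of the truncation\<close>

context matroid
begin

lemma is_flat_ground: "is_flat M (ground M)"
  by (simp add: is_flat_def)

lemma flags_eq_partial_flags:
  "flags M = (\<lambda>Ys. Ys @ [ground M]) ` partial_flags M (mrank M (ground M))"
proof (intro set_eqI iffI)
  let ?r = "mrank M (ground M)"
  fix Xs assume Xs: "Xs \<in> flags M"
  then have "length Xs = Suc ?r" by (simp add: flags_def)
  then obtain Ys H where YH: "Xs = Ys @ [H]" "length Ys = ?r" by (metis length_Suc_conv_rev)
  have "H = ground M" using Xs YH by (simp add: flags_def nth_append)
  moreover have "is_flat M (Ys ! j) \<and> mrank M (Ys ! j) = j" if "j < ?r" for j
    using Xs YH that unfolding flags_def by (auto simp: nth_append dest!: spec[of _ j])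
  moreover have "Ys ! j \<subset> Ys ! Suc j" if "Suc j < ?r" for j
    using Xs YH that unfolding flags_def by (auto simp: nth_append dest!: spec[of _ j])
  ultimately show "Xs \<in> (\<lambda>Ys. Ys @ [ground M]) ` partial_flags M ?r"
    using YH by (auto simp: partial_flags_def)
next
  let ?r = "mrank M (ground M)"
  fix Xs assume "Xs \<in> (\<lambda>Ys. Ys @ [ground M]) ` partial_flags M ?r"
  then obtain Ys where Ys: "Xs = Ys @ [ground M]" "Ys \<in> partial_flags M ?r" by auto
  have "Ys ! j \<subset> ground M" if "j < ?r" for j
    using Ys(2) that by (auto simp: partial_flags_def is_flat_def)
  then show "Xs \<in> flags M"
    using Ys is_flat_ground by (auto simp: partial_flags_def flags_def nth_append less_Suc_eq)
qed

lemma mrank_Trun_eq_min: "mrank (Trun M) X = min (mrank M X) (mrank M (ground M) - 1)"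
proof (rule antisym)
  interpret T: matroid "Trun M" by (rule matroid_Trun)
  obtain Y where "Y \<in> indeps (Trun M)" "Y \<subseteq> X" "card Y = mrank (Trun M) X"
    using T.mrank_witness by blast
  then show "mrank (Trun M) X \<le> min (mrank M X) (mrank M (ground M) - 1)"
    using mrank_ge[of Y X] by (simp add: indeps_Trun)
  obtain Y where Y: "Y \<in> indeps M" "Y \<subseteq> X" "card Y = mrank M X" using mrank_witness by blast
  \<comment> \<open>A maximum independent subset of \<open>X\<close> may be too large for
    \<open>Trun M\<close>; cutting it down to the cap attains the minimum.\<close>
  obtain Z where Z: "Z \<subseteq> Y" "card Z = min (mrank M X) (mrank M (ground M) - 1)"
    using obtain_subset_with_card_n[of "min (mrank M X) (mrank M (ground M) - 1)" Y] Y(3)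
    by (metis min.cobounded1)
  then have "Z \<in> indeps (Trun M)" using indep_subset[OF Y(1)] by (simp add: indeps_Trun)
  then show "min (mrank M X) (mrank M (ground M) - 1) \<le> mrank (Trun M) X"
    using T.mrank_ge[of Z X] Z Y(2) by simp
qed

text \<open>The strict bound leaves room for the rank to rise by 1 below the cap, so the same
  elements raise the rank in both matroids.\<close>

lemma is_flat_Trun:
  assumes "mrank M X < mrank M (ground M) - 1"
  shows "is_flat (Trun M) X \<longleftrightarrow> is_flat M X"
proof -
  have "mrank (Trun M) X = mrank M X" using assms by (simp add: mrank_Trun_eq_min)
  then show ?thesis using assms by (simp add: is_flat_def ground_Trun) (simp add: mrank_Trun_eq_min)
qed

lemma partial_flags_Trun:
  "partial_flags (Trun M) (mrank M (ground M) - 1) = partial_flags M (mrank M (ground M) - 1)"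
proof -
  have "is_flat (Trun M) X \<and> mrank (Trun M) X = j \<longleftrightarrow> is_flat M X \<and> mrank M X = j"
    if "j < mrank M (ground M) - 1" for X j
    using that is_flat_Trun[of X] by (auto simp: mrank_Trun_eq_min min_def split: if_splits)
  then show ?thesis unfolding partial_flags_def by auto
qed

section \<open>Weighted count of flags by their hyperplane\<close>

lemma finite_partial_flags: "finite (partial_flags M k)"
proof (rule finite_subset)
  show "partial_flags M k \<subseteq> {Xs. set Xs \<subseteq> Pow (ground M) \<and> length Xs = k}"
    unfolding partial_flags_def is_flat_def by (force simp: in_set_conv_nth)
  show "finite {Xs. set Xs \<subseteq> Pow (ground M) \<and> length Xs = k}"
    using finite_ground by (intro finite_lists_length_eq) simp
qed

lemma finite_flat_covers: "finite (flat_covers M X)"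
  by (rule finite_subset[of _ "Pow (ground M)"])
    (auto simp: flat_covers_def is_flat_def finite_ground)

lemma sum_card_flat_covers:
  assumes X: "is_flat M X"
  shows "(\<Sum>H\<in>flat_covers M X. card (H - X)) = card (ground M - X)"
proof -
  have rank: "mrank M (insert x X) = Suc (mrank M X)" if "x \<in> ground M - X" for x
    using X that mrank_insert_le[of x X] by (force simp: is_flat_def)
  \<comment> \<open>A cover of \<open>X\<close> is determined by any of its elements outside \<open>X\<close>, so covers meet only in \<open>X\<close>.\<close>
  have eq: "H = mclosure M (insert x X)" if "H \<in> flat_covers M X" "x \<in> H - X" for H x
  proof (rule mclosure_eq_flat[symmetric])
    show "is_flat M H" "insert x X \<subseteq> H" using that by (auto simp: flat_covers_def)
    then show "mrank M (insert x X) = mrank M H"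
      using that rank[of x] by (auto simp: flat_covers_def is_flat_def)
  qed
  have "card (\<Union>H\<in>flat_covers M X. H - X) = (\<Sum>H\<in>flat_covers M X. card (H - X))"
  proof (rule card_UN_disjoint)
    show "finite (flat_covers M X)" by (rule finite_flat_covers)
    show "\<forall>H\<in>flat_covers M X. finite (H - X)"
      using finite_ground by (auto simp: flat_covers_def is_flat_def intro: finite_subset)
    show "\<forall>H\<in>flat_covers M X. \<forall>K\<in>flat_covers M X. H \<noteq> K \<longrightarrow> (H - X) \<inter> (K - X) = {}"
      using eq by blast
  qed
  moreover have "(\<Union>H\<in>flat_covers M X. H - X) = ground M - X"
  proof (intro set_eqI iffI)
    fix x assume "x \<in> (\<Union>H\<in>flat_covers M X. H - X)"
    then show "x \<in> ground M - X" by (auto simp: flat_covers_def is_flat_def)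
  next
    \<comment> \<open>The cover through \<open>x\<close> is the closure of
      \<open>insert x X\<close>.\<close>
    fix x assume x: "x \<in> ground M - X"
    then have sub: "insert x X \<subseteq> ground M" using X by (auto simp: is_flat_def)
    have "insert x X \<subseteq> mclosure M (insert x X)" using sub by (rule subset_mclosure)
    moreover from this have "mclosure M (insert x X) \<in> flat_covers M X"
      using x is_flat_mclosure[OF sub] mrank_mclosure[OF sub] rank[OF x]
      by (auto simp: flat_covers_def)
    ultimately show "x \<in> (\<Union>H\<in>flat_covers M X. H - X)" using x by blast
  qed
  ultimately show ?thesis by simp
qed

text \<open>Double counting with the denominator cleared, so that it stays in the naturals: a flag
  of \<open>M\<close> has weight \<open>card (H - last Ys)\<close>, and the weights over one flag of
  \<open>Trun M\<close> add up to \<open>a'\<close>.\<close>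

lemma nu_Trun_mult:
  assumes r: "2 \<le> mrank M (ground M)"
    and a: "a @ [a'] \<in> compositions (card (ground M)) (mrank M (ground M) - 1)"
  shows "nu (Trun M) (a @ [a']) * a' =
    (\<Sum>(x, y)\<in>{(x, y). 0 < x \<and> 0 < y \<and> x + y = a'}. nu M (a @ [x, y]) * x)"
proof -
  interpret T: matroid "Trun M" by (rule matroid_Trun)
  let ?E = "ground M" and ?r = "mrank M (ground M)"
  let ?S = "{(x, y). 0 < x \<and> 0 < y \<and> x + y = a'}"
  \<comment> \<open>\<open>N\<close> indexes the flags of \<open>Trun M\<close> to be counted,
    \<open>Z\<close> adds a hyperplane, \<open>f\<close> turns such a pair into a flag of
    \<open>M\<close>, and \<open>g\<close> reads off the last two entries of its
    composition.\<close>
  define N where "N = {Ys \<in> partial_flags M (?r - 1). flag_composition Ys = a}"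
  define Z where "Z = (SIGMA Ys:N. flat_covers M (last Ys))"
  define f where "f = (\<lambda>(Ys, H). Ys @ [H, ?E])"
  define g where "g = (\<lambda>(Ys, H). (card (H - last Ys), card (?E - H)))"
  have flagsT: "flags (Trun M) = (\<lambda>Ys. Ys @ [?E]) ` partial_flags M (?r - 1)"
    using T.flags_eq_partial_flags unfolding ground_Trun mrank_Trun partial_flags_Trun .
  \<comment> \<open>Rank at least 2 ensures that a flat remains below the hyperplane, as
    \<open>partial_flags_Suc\<close> demands.\<close>
  have "Suc (?r - 1) = ?r" "0 < ?r - 1" using r by auto
  then have flagsM: "flags M = f ` (SIGMA Ys:partial_flags M (?r - 1). flat_covers M (last Ys))"
    using partial_flags_Suc[of "?r - 1" M] unfolding flags_eq_partial_flags f_def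
    by (auto simp: image_image case_prod_unfold)
  have ne: "Ys \<noteq> []" if "Ys \<in> partial_flags M (?r - 1)" for Ys
    using that r by (auto simp: partial_flags_def)
  have compT: "flag_composition (Ys @ [?E]) = flag_composition Ys @ [card (?E - last Ys)]"
    if "Ys \<in> partial_flags M (?r - 1)" for Ys
    using ne[OF that] by (rule flag_composition_snoc)
  have compM: "flag_composition (f (Ys, H)) =
      flag_composition Ys @ [card (H - last Ys), card (?E - H)]"
    if "Ys \<in> partial_flags M (?r - 1)" for Ys H
    using flag_composition_snoc[OF ne[OF that], of H] flag_composition_snoc[of "Ys @ [H]" ?E]
    by (simp add: f_def)
  have last_flat: "is_flat M (last Ys)" "mrank M (last Ys) = ?r - 2" if "Ys \<in> N" for Ys
  proof -
    have "last Ys = Ys ! (?r - 2)" "?r - 2 < ?r - 1"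
      using that ne[of Ys] r by (auto simp: N_def partial_flags_def last_conv_nth numeral_2_eq_2)
    then show "is_flat M (last Ys)" "mrank M (last Ys) = ?r - 2"
      using that by (auto simp: N_def partial_flags_def)
  qed
  \<comment> \<open>Both compositions sum to the size of the ground set and agree on
    \<open>a\<close>, so the last entry is forced.\<close>
  have card_last: "card (?E - last Ys) = a'" if "Ys \<in> N" for Ys
  proof -
    have Ys: "Ys \<in> partial_flags M (?r - 1)" "flag_composition Ys = a" using that by (auto simp: N_def)
    then have "Ys @ [?E] \<in> flags (Trun M)" using flagsT by auto
    then have "flag_composition (Ys @ [?E]) \<in> compositions (card ?E) (?r - 1)"
      using T.flag_composition_in_compositions by (simp add: ground_Trun mrank_Trun)
    then show ?thesis using a Ys by (auto simp: compT compositions_def)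
  qed
  have "{Xs \<in> flags (Trun M). flag_composition Xs = a @ [a']} = (\<lambda>Ys. Ys @ [?E]) ` N"
    unfolding flagsT using compT card_last by (auto simp: N_def)
  then have nuT: "nu (Trun M) (a @ [a']) = card N"
    by (simp add: nu_def card_image inj_on_def)
  have nuM: "nu M (a @ [x, y]) = card {z \<in> Z. g z = (x, y)}" for x y
  proof -
    have "{Xs \<in> flags M. flag_composition Xs = a @ [x, y]} = f ` {z \<in> Z. g z = (x, y)}"
      unfolding flagsM using compM by (auto simp: N_def Z_def g_def)
    moreover have "inj_on f A" for A by (auto simp: f_def inj_on_def)
    ultimately show ?thesis by (simp add: nu_def card_image)
  qed
  have finN: "finite N" using finite_partial_flags by (simp add: N_def)
  then have finZ: "finite Z" using finite_flat_covers by (simp add: Z_def)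
  \<comment> \<open>The hyperplane has rank one below the top, so it is proper; both entries are
    positive and no weighted pair escapes the index set.\<close>
  have gS: "g ` Z \<subseteq> ?S"
  proof (rule image_subsetI)
    fix z assume "z \<in> Z"
    then obtain Ys H where z: "z = (Ys, H)" and Ys: "Ys \<in> N"
      and H: "is_flat M H" "mrank M H = Suc (mrank M (last Ys))" "last Ys \<subset> H"
      by (auto simp: Z_def flat_covers_def)
    have fin: "finite H" "H \<subseteq> ?E" using H(1) finite_ground by (auto simp: is_flat_def intro: finite_subset)
    have "H \<noteq> ?E" using H(2) last_flat(2)[OF Ys] r by auto
    then have "0 < card (?E - H)" using fin finite_ground by (auto simp: card_gt_0_iff)
    moreover have "0 < card (H - last Ys)" using H(3) fin by (auto simp: card_gt_0_iff)
    moreover have "card (H - last Ys) + card (?E - H) = card (?E - last Ys)"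
      using H(3) fin finite_ground
      by (subst card_Un_disjoint[symmetric]) (auto intro: arg_cong[of _ _ card])
    ultimately show "g z \<in> ?S" using z card_last[OF Ys] by (simp add: g_def)
  qed
  have "finite ?S" by (rule finite_subset[of _ "{..a'} \<times> {..a'}"]) auto
  \<comment> \<open>On the fibre of \<open>g\<close> over \<open>(x, y)\<close> the weight
    \<open>x\<close> is \<open>fst (g z)\<close>, so the fibres combine into one sum over
    \<open>Z\<close>.\<close>
  have "(\<Sum>(x, y)\<in>?S. nu M (a @ [x, y]) * x) = (\<Sum>p\<in>?S. \<Sum>z\<in>{z \<in> Z. g z = p}. fst (g z))"
    by (intro sum.cong) (auto simp: nuM)
  also have "\<dots> = (\<Sum>z\<in>Z. fst (g z))" using finZ \<open>finite ?S\<close> gS by (rule sum.group)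
  also have "\<dots> = (\<Sum>Ys\<in>N. \<Sum>H\<in>flat_covers M (last Ys). card (H - last Ys))"
    unfolding Z_def using finN finite_flat_covers
    by (subst sum.Sigma) (auto simp: g_def case_prod_unfold)
  also have "\<dots> = card N * a'"
    by (simp add: sum_card_flat_covers last_flat card_last)
  finally show ?thesis using nuT by simp
qed

lemma nu_Trun:
  assumes r: "2 \<le> mrank M (ground M)"
    and a: "a @ [a'] \<in> compositions (card (ground M)) (mrank M (ground M) - 1)"
  shows "(of_nat (nu (Trun M) (a @ [a'])) :: 'k::field_char_0) =
    (\<Sum>(x, y)\<in>{(x, y). 0 < x \<and> 0 < y \<and> x + y = a'}.
      of_nat (nu M (a @ [x, y])) * (of_nat x / of_nat (x + y)))"
proof -
  let ?S = "{(x, y). 0 < x \<and> 0 < y \<and> x + y = a'}"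
  \<comment> \<open>The index of \<open>a'\<close> is at least 1, so it is one of the positive
    entries and division by it is allowed.\<close>
  have "length a = mrank M (ground M) - 1" "0 < (a @ [a']) ! (mrank M (ground M) - 1)"
    using a r by (auto simp: compositions_def)
  then have pos: "0 < a'" by (simp add: nth_append)
  have "(of_nat (nu (Trun M) (a @ [a'])) :: 'k) =
      of_nat (nu (Trun M) (a @ [a']) * a') / of_nat a'"
    using pos by simp
  also have "\<dots> = (\<Sum>(x, y)\<in>?S. of_nat (nu M (a @ [x, y]) * x)) / of_nat a'"
    unfolding nu_Trun_mult[OF assms] by (simp add: case_prod_unfold)
  also have "\<dots> = (\<Sum>(x, y)\<in>?S. of_nat (nu M (a @ [x, y])) * (of_nat x / of_nat (x + y)))"
    unfolding sum_divide_distrib by (intro sum.cong) auto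
  finally show ?thesis .
qed

text \<open>\<open>G_inv_eq_sum_gamma\<close> is applied to \<open>Trun M\<close> and its flag
  counts are replaced by \<open>nu_Trun\<close>. The pairs of a composition and a splitting of its
  last entry are then reindexed by the finer composition.\<close>

lemma G_inv_Trun:
  assumes r: "2 \<le> mrank M (ground M)"
  defines "r \<equiv> mrank M (ground M)"
  shows "(G_inv (Trun M) :: nat list \<Rightarrow>\<^sub>0 'k::field_char_0) =
    (\<Sum>a\<in>compositions (card (ground M)) r.
      scale (of_nat (nu M a) * (of_nat (a ! (r - 1)) / of_nat (a ! (r - 1) + a ! r)))
        (gamma (take (r - 1) a @ [a ! (r - 1) + a ! r])))"
proof -
  interpret V: vector_space "scale :: 'k \<Rightarrow> _" by (rule vector_space_scale)
  interpret T: matroid "Trun M" by (rule matroid_Trun)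
  let ?n = "card (ground M)"
  let ?S = "\<lambda>c. {(x, y). 0 < x \<and> 0 < y \<and> x + y = last c} :: (nat \<times> nat) set"
  let ?w = "\<lambda>c x y. scale (of_nat (nu M (butlast c @ [x, y])) * (of_nat x / of_nat (x + y)) :: 'k)
    (gamma c)"
  have fin: "finite (?S c)" for c
    by (rule finite_subset[of _ "{..last c} \<times> {..last c}"]) auto
  have len: "length c = r" if "c \<in> compositions ?n (r - 1)" for c
    using that r by (simp add: compositions_def r_def)
  have "(G_inv (Trun M) :: nat list \<Rightarrow>\<^sub>0 'k) =
      (\<Sum>c\<in>compositions ?n (r - 1). scale (of_nat (nu (Trun M) c)) (gamma c))"
    using T.G_inv_eq_sum_gamma by (simp add: ground_Trun mrank_Trun r_def)
  also have "\<dots> = (\<Sum>c\<in>compositions ?n (r - 1). \<Sum>(x, y)\<in>?S c. ?w c x y)"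
  proof (rule sum.cong)
    fix c assume c: "c \<in> compositions ?n (r - 1)"
    then have "c \<noteq> []" using len[OF c] r by (auto simp: r_def)
    then have eq: "butlast c @ [last c] = c" by simp
    have "(of_nat (nu (Trun M) c) :: 'k) =
        (\<Sum>(x, y)\<in>?S c. of_nat (nu M (butlast c @ [x, y])) * (of_nat x / of_nat (x + y)))"
      using nu_Trun[OF r, of "butlast c" "last c"] c unfolding eq r_def by simp
    then show "scale (of_nat (nu (Trun M) c) :: 'k) (gamma c) = (\<Sum>(x, y)\<in>?S c. ?w c x y)"
      by (simp only: V.scale_sum_left case_prod_unfold)
  qed simp
  also have "\<dots> = (\<Sum>(c, x, y)\<in>(SIGMA c:compositions ?n (r - 1). ?S c). ?w c x y)"
    by (rule sum.Sigma) (auto simp: finite_compositions fin)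
  also have "\<dots> = (\<Sum>a\<in>compositions ?n r.
      scale (of_nat (nu M a) * (of_nat (a ! (r - 1)) / of_nat (a ! (r - 1) + a ! r)))
        (gamma (take (r - 1) a @ [a ! (r - 1) + a ! r])))"
  \<comment> \<open>Here \<open>i\<close> merges the last two entries and remembers them,
    \<open>j\<close> splits the last entry.\<close>
  proof (rule sum.reindex_bij_witness[where
      i = "\<lambda>a. (take (r - 1) a @ [a ! (r - 1) + a ! r], a ! (r - 1), a ! r)" and
      j = "\<lambda>(c, x, y). butlast c @ [x, y]"])
    fix p assume "p \<in> (SIGMA c:compositions ?n (r - 1). ?S c)"
    then obtain c x y where p: "p = (c, x, y)" "c \<in> compositions ?n (r - 1)"
      "0 < x" "0 < y" "x + y = last c" by auto
    obtain d z where d: "c = d @ [z]"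
      using len[OF p(2)] r by (cases c rule: rev_cases) (auto simp: r_def)
    have lend: "length d = r - 1" and z: "z = x + y" using len[OF p(2)] p(5) d by auto
    obtain q where q: "r = Suc q" using r by (cases r) (auto simp: r_def)
    show "(\<lambda>a. (take (r - 1) a @ [a ! (r - 1) + a ! r], a ! (r - 1), a ! r))
        ((\<lambda>(c, x, y). butlast c @ [x, y]) p) = p"
      using lend z p(1) d q by (simp add: nth_append)
    have "0 < (d @ [x, y]) ! j" if "j \<in> {1..r}" for j
    proof -
      \<comment> \<open>\<open>d\<close> has length \<open>q\<close>, so \<open>x\<close> sits at
        index \<open>q\<close> and \<open>y\<close> at \<open>Suc q\<close>; the earlier entries
        come from \<open>c\<close>.\<close>
      consider "j < q" | "j = q" | "j = Suc q" using \<open>j \<in> {1..r}\<close> q by fastforce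
      then show ?thesis
      proof cases
        case 1
        then have "0 < c ! j" using p(2) q that by (auto simp: compositions_def)
        then show ?thesis using 1 d lend q by (simp add: nth_append)
      qed (use lend q p(3,4) in \<open>simp_all add: nth_append\<close>)
    qed
    then have "d @ [x, y] \<in> compositions ?n r"
      using p(2) lend z d q by (simp add: compositions_def)
    then show "(\<lambda>(c, x, y). butlast c @ [x, y]) p \<in> compositions ?n r"
      using p(1) d by simp
    show "scale (of_nat (nu M ((\<lambda>(c, x, y). butlast c @ [x, y]) p)) *
          (of_nat ((\<lambda>(c, x, y). butlast c @ [x, y]) p ! (r - 1)) /
            of_nat ((\<lambda>(c, x, y). butlast c @ [x, y]) p ! (r - 1) +
              (\<lambda>(c, x, y). butlast c @ [x, y]) p ! r)) :: 'k)
        (gamma (take (r - 1) ((\<lambda>(c, x, y). butlast c @ [x, y]) p) @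
          [(\<lambda>(c, x, y). butlast c @ [x, y]) p ! (r - 1) +
            (\<lambda>(c, x, y). butlast c @ [x, y]) p ! r])) = (\<lambda>(c, x, y). ?w c x y) p"
      using lend z p(1) d q by (simp add: nth_append)
  next
    fix a assume a: "a \<in> compositions ?n r"
    obtain q where q: "r = Suc q" "0 < q" using r by (cases r) (auto simp: r_def)
    have lena: "length a = Suc (Suc q)" using a q by (simp add: compositions_def)
    have eq: "take q a @ [a ! q, a ! Suc q] = a"
      using take_Suc_conv_app_nth[of q a] take_Suc_conv_app_nth[of "Suc q" a] lena by simp
    then show "(\<lambda>(c, x, y). butlast c @ [x, y])
        (take (r - 1) a @ [a ! (r - 1) + a ! r], a ! (r - 1), a ! r) = a"
      using q by simp
    have "sum_list (take q a @ [a ! q, a ! Suc q]) = ?n" unfolding eq using a by (simp add: compositions_def)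
    then have "take q a @ [a ! q + a ! Suc q] \<in> compositions ?n q" "0 < a ! q" "0 < a ! Suc q"
      using a q lena by (auto simp: compositions_def nth_append)
    then show "(take (r - 1) a @ [a ! (r - 1) + a ! r], a ! (r - 1), a ! r)
        \<in> (SIGMA c:compositions ?n (r - 1). ?S c)"
      using q by simp
  qed
  finally show ?thesis .
qed

end

text \<open>In rank 1 both identities fail: the truncation has a single flag, but the right-hand
  sides give it the weight a_0/n < 1, where a_0 is the number of loops. The first identity is over
  the rationals, the second over any field of characteristic zero.\<close>

theorem proposition9p1:
  fixes M :: "'a set_system" and n r :: nat
  assumes "matroid M"
    and "card (ground M) = n"
    and "mrank M (ground M) = r"
    and "2 \<le> r"
  shows "(\<forall>a a'. a @ [a'] \<in> compositions n (r - 1) \<longrightarrow>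
      rat_of_nat (nu (Trun M) (a @ [a'])) =
        (\<Sum>(x, y)\<in>{(x, y). 0 < x \<and> 0 < y \<and> x + y = a'}.
          rat_of_nat (nu M (a @ [x, y])) * (rat_of_nat x / rat_of_nat (x + y))))
    \<and> (G_inv (Trun M) :: nat list \<Rightarrow>\<^sub>0 'k::field_char_0) =
        (\<Sum>a\<in>compositions n r.
          scale (of_nat (nu M a) * (of_nat (a ! (r - 1)) / of_nat (a ! (r - 1) + a ! r)))
            (gamma (take (r - 1) a @ [a ! (r - 1) + a ! r])))"
proof -
  interpret matroid M by fact
  have r: "2 \<le> mrank M (ground M)" using assms by simp
  show ?thesis using nu_Trun[where ?'k = rat, OF r] G_inv_Trun[where ?'k = 'k, OF r] assms(2,3) by simp
qed

end
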